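(* For every Borel $K\subseteq X_\omega$ with $0<\gamma_\omega(K)$ and for every $\epsilon>0$ there are $m,n\in\mathbb{N}$ with $$\gamma_\omega\Big(\bigcup_{k=n}^{n+m} g_{\epsilon,k}\cdot K\Big)>1-\epsilon.$$
   Context: $\mathbb{N}$ includes $0$. $2^n$ is the set of binary sequences of length $n$, $2^{<\omega}$ the set of all finite binary sequences, $\emptyset$ the empty sequence, $|\sigma|$ the length of $\sigma$, and $\sigma\tau$ denotes concatenation; $\sigma 0$ and $\sigma 1$ are the one-term extensions of $\sigma$. $U(1)$ is the circle group. The space $X_\omega$: it is the set of all functions $\mathbf{x}:2^{<\omega}\to\mathbb{C}$ such that $\mathbf{x}(\sigma)=\frac{\mathbf{x}(\sigma 0)+\mathbf{x}(\sigma 1)}{\sqrt2}$ for all $\sigma\in 2^{<\omega}$, a closed linear subspace of $\mathbb{C}^{2^{<\omega}}$ with the product topology. The measure $\gamma_\omega$: let $\gamma$ be the standard Gaussian measure on $\mathbb{C}=\mathbb{R}^2$, with density $\frac1{2\pi}e^{-(x^2+y^2)/2}$ with respect to Lebesgue measure. Let $I=2^{<\omega}\cup\{*\}$, where $*\notin 2^{<\omega}$, and let $\gamma^I$ be the product measure on $\mathbb{C}^I$. The map $\Phi:X_\omega\to\mathbb{C}^I$ given by $\Phi(\mathbf{x})( * )=\mathbf{x}(\emptyset)$ and $\Phi(\mathbf{x})(\sigma)=\frac{\mathbf{x}(\sigma 0)-\mathbf{x}(\sigma 1)}{\sqrt2}$ for $\sigma\in 2^{<\omega}$ is a linear bijection,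 and $\gamma_\omega(A)=\gamma^I(\Phi(A))$ for Borel $A\subseteq X_\omega$. The action: $S_n$ is the group of all $g\in C(2^{\mathbb{N}},U(1))$ such that $g(x)$ depends only on the first $n$ coordinates of $x\in 2^{\mathbb{N}}$, and $S_\omega=\bigcup_n S_n$. For $g\in S_n$ and $\sigma\in 2^m$ with $m\ge n$, $g(\sigma)$ denotes the common value of $g(x)$ for $x\in 2^{\mathbb{N}}$ extending $\sigma$. For $g\in S_n$ and $\mathbf{x}\in X_\omega$, $g\cdot\mathbf{x}$ is the unique element of $X_\omega$ with $(g\cdot\mathbf{x})(\sigma)=g(\sigma)\mathbf{x}(\sigma)$ for all $\sigma$ with $|\sigma|\ge n$; this defines an action of $S_\omega$ on $X_\omega$ preserving $\gamma_\omega$. For $K\subseteq X_\omega$, $g\cdot K=\{g\cdot\mathbf{x}:\mathbf{x}\in K\}$. For $s\in\mathbb{R}$ and $k\in\mathbb{N}$, $g_{s,k}\in C(2^{\mathbb{N}},U(1))$ (an element of $S_{k+1}$, coordinates being indexed from $0$) is defined by $$g_{s,k}(x)=\frac{1+is(-1)^{x(k)}}{\sqrt{1+s^2}}.$$ *)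

theory Defs
  imports "HOL-Probability.Probability"
begin

text \<open>
  Finite binary sequences are of type \<open>bool list\<close> and elements of Cantor space of type
  \<open>nat \<Rightarrow> bool\<close>, with \<open>False\<close> for the digit 0 and \<open>True\<close> for the digit 1. Function types
  carry the product topology.
\<close>

definition X_omega :: "(bool list \<Rightarrow> complex) set" where
  "X_omega = {x. \<forall>\<sigma>. x \<sigma> = (x (\<sigma> @ [False]) + x (\<sigma> @ [True])) / complex_of_real (sqrt 2)}"

definition gauss :: "complex measure" where
  "gauss = density lborel (\<lambda>z. ennreal (1 / (2 * pi) * exp (- ((Re z)\<^sup>2 + (Im z)\<^sup>2) / 2)))"

text \<open>The index set \<open>I\<close> is the type \<open>bool list option\<close>, with \<open>None\<close> as the extra point.\<close>

definition gauss_I :: "(bool list option \<Rightarrow> complex) measure" where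
  "gauss_I = PiM UNIV (\<lambda>_. gauss)"

definition Phi :: "(bool list \<Rightarrow> complex) \<Rightarrow> (bool list option \<Rightarrow> complex)" where
  "Phi x = (\<lambda>i. case i of
      None \<Rightarrow> x []
    | Some \<sigma> \<Rightarrow> (x (\<sigma> @ [False]) - x (\<sigma> @ [True])) / complex_of_real (sqrt 2))"

definition gamma_omega :: "(bool list \<Rightarrow> complex) measure" where
  "gamma_omega = measure_of X_omega (sets (restrict_space borel X_omega))
     (\<lambda>A. emeasure gauss_I (Phi ` A))"

definition S_level :: "nat \<Rightarrow> ((nat \<Rightarrow> bool) \<Rightarrow> complex) set" where
  "S_level n = {g. continuous_on UNIV g \<and> range g \<subseteq> sphere 0 1 \<and>
             (\<forall>x y. (\<forall>i<n. x i = y i) \<longrightarrow> g x = g y)}"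

definition S_omega :: "((nat \<Rightarrow> bool) \<Rightarrow> complex) set" where
  "S_omega = (\<Union>n. S_level n)"

definition extends :: "(nat \<Rightarrow> bool) \<Rightarrow> bool list \<Rightarrow> bool" where
  "extends x \<sigma> \<longleftrightarrow> (\<forall>i<length \<sigma>. x i = \<sigma> ! i)"

definition cyl_val :: "((nat \<Rightarrow> bool) \<Rightarrow> complex) \<Rightarrow> bool list \<Rightarrow> complex" where
  "cyl_val g \<sigma> = (THE c. \<forall>x. extends x \<sigma> \<longrightarrow> g x = c)"

text \<open>
  The index \<open>n\<close> with \<open>g \<in> S_level n\<close> is not unique, but the element described does not depend on it
  (see \<open>act_eqI\<close>). Outside \<open>S_omega\<close> the value is unspecified.
\<close>

definition act :: "((nat \<Rightarrow> bool) \<Rightarrow> complex) \<Rightarrow> (bool list \<Rightarrow> complex) \<Rightarrow> (bool list \<Rightarrow> complex)" where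
  "act g x = (THE y. y \<in> X_omega \<and>
     (\<forall>n. g \<in> S_level n \<longrightarrow> (\<forall>\<sigma>. n \<le> length \<sigma> \<longrightarrow> y \<sigma> = cyl_val g \<sigma> * x \<sigma>)))"

definition gs :: "real \<Rightarrow> nat \<Rightarrow> (nat \<Rightarrow> bool) \<Rightarrow> complex" where
  "gs s k x = (1 + \<i> * complex_of_real s * (-1) ^ of_bool (x k)) / complex_of_real (sqrt (1 + s\<^sup>2))"


subsection \<open>The measure is well defined\<close>

lemma space_gamma_omega [simp]: "space gamma_omega = X_omega"
  unfolding gamma_omega_def by (rule space_measure_of) (use sets.space_closed[of "restrict_space borel X_omega"] in \<open>simp add: space_restrict_space\<close>)

lemma sets_gamma_omega [simp]: "sets gamma_omega = sets (restrict_space borel X_omega)"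
  using sets.sets_measure_of_eq[of "restrict_space borel X_omega"]
  by (simp add: gamma_omega_def space_restrict_space)

fun Psi_rev :: "(bool list option \<Rightarrow> complex) \<Rightarrow> bool list \<Rightarrow> complex" where
  "Psi_rev y [] = y None"
| "Psi_rev y (b # r) =
     (Psi_rev y r + (if b then - y (Some (rev r)) else y (Some (rev r)))) / complex_of_real (sqrt 2)"

text \<open>The inverse of \<open>Phi\<close>, by recursion on the reversed argument.\<close>

definition Psi :: "(bool list option \<Rightarrow> complex) \<Rightarrow> (bool list \<Rightarrow> complex)" where
  "Psi y \<sigma> = Psi_rev y (rev \<sigma>)"

lemma sqrt2_sq: "complex_of_real (sqrt 2) * complex_of_real (sqrt 2) = 2"
  by (simp flip: of_real_mult)

lemma Psi_in: "Psi y \<in> X_omega"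
  using sqrt2_sq by (auto simp: X_omega_def Psi_def field_simps)

lemma Phi_Psi: "Phi (Psi y) = y"
proof
  fix i show "Phi (Psi y) i = y i"
    using sqrt2_sq by (cases i) (auto simp: Phi_def Psi_def field_simps)
qed

lemma Psi_Phi:
  assumes "x \<in> X_omega" shows "Psi (Phi x) = x"
proof
  fix \<sigma>
  show "Psi (Phi x) \<sigma> = x \<sigma>"
  proof (induction \<sigma> rule: rev_induct)
    case Nil
    show ?case by (simp add: Psi_def Phi_def)
  next
    case (snoc b \<sigma>)
    have h: "x \<sigma> = (x (\<sigma> @ [False]) + x (\<sigma> @ [True])) / complex_of_real (sqrt 2)"
      using assms unfolding X_omega_def by blast
    have "Psi (Phi x) (\<sigma> @ [b]) =
      (Psi (Phi x) \<sigma> + (if b then - Phi x (Some \<sigma>) else Phi x (Some \<sigma>))) / complex_of_real (sqrt 2)"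
      by (simp add: Psi_def)
    also have "\<dots> = (x \<sigma> + (if b then - Phi x (Some \<sigma>) else Phi x (Some \<sigma>))) / complex_of_real (sqrt 2)"
      by (simp only: snoc)
    also have "\<dots> = x (\<sigma> @ [b])"
      by (subst h) (use sqrt2_sq in \<open>cases b; simp add: Phi_def field_simps\<close>)
    finally show ?case .
  qed
qed

lemma bij_Phi: "bij_betw Phi X_omega UNIV"
  by (rule bij_betw_byWitness[of _ Psi]) (auto simp: Phi_Psi Psi_Phi Psi_in)

lemma sets_gauss [simp, measurable_cong]: "sets gauss = sets borel"
  by (simp add: gauss_def)

lemma prob_space_gauss: "prob_space gauss"
proof
  have sp: "space gauss = UNIV" by (simp add: gauss_def)
  have B: "(Basis :: complex set) = {1, \<i>}" by (simp add: Basis_complex_def)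
  have "emeasure gauss (space gauss) =
      (\<integral>\<^sup>+z. ennreal (1 / (2 * pi) * exp (- ((Re z)\<^sup>2 + (Im z)\<^sup>2) / 2)) \<partial>lborel)"
    unfolding sp by (simp add: gauss_def emeasure_density)
  also have "\<dots> = (\<integral>\<^sup>+z. (\<Prod>b\<in>Basis. ennreal (std_normal_density (z \<bullet> b))) \<partial>(lborel :: complex measure))"
  proof (rule nn_integral_cong)
    fix z :: complex
    have "1 / (2 * pi) * exp (- ((Re z)\<^sup>2 + (Im z)\<^sup>2) / 2)
        = std_normal_density (Re z) * std_normal_density (Im z)"
      by (simp add: std_normal_density_def field_simps add_divide_distrib flip: exp_add)
    then show "ennreal (1 / (2 * pi) * exp (- ((Re z)\<^sup>2 + (Im z)\<^sup>2) / 2))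
        = (\<Prod>b\<in>Basis. ennreal (std_normal_density (z \<bullet> b)))"
      by (simp add: B inner_complex_def ennreal_mult)
  qed
  also have "\<dots> = (\<Prod>b\<in>(Basis :: complex set). \<integral>\<^sup>+x. ennreal (std_normal_density x) \<partial>lborel)"
    by (rule nn_integral_lborel_prod) auto
  also have "(\<integral>\<^sup>+x. ennreal (std_normal_density x) \<partial>lborel) = 1"
  proof -
    interpret p: prob_space "density lborel std_normal_density"
      by (rule prob_space_normal_density) simp
    show ?thesis using p.emeasure_space_1 by (simp add: emeasure_density)
  qed
  finally show "emeasure gauss (space gauss) = 1" by simp
qed

lemma space_gauss_I [simp]: "space gauss_I = UNIV"
  by (auto simp: gauss_I_def space_PiM gauss_def)

lemma measurable_Psi: "Psi \<in> measurable gauss_I (restrict_space borel X_omega)"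
proof (rule measurable_restrict_space2)
  show "Psi \<in> space gauss_I \<rightarrow> X_omega" by (simp add: Psi_in)
  have "(\<lambda>y. Psi_rev y r) \<in> borel_measurable gauss_I" for r
    by (induction r) (auto simp: gauss_I_def)
  then show "Psi \<in> borel_measurable gauss_I"
    by (intro measurable_coordinatewise_then_product) (simp add: Psi_def)
qed

lemma Phi_image: "A \<subseteq> X_omega \<Longrightarrow> Phi ` A = Psi -` A \<inter> space gauss_I"
  by (auto simp: Psi_Phi subset_iff) (metis Phi_Psi image_eqI)

lemma gamma_omega_eq_distr: "gamma_omega = distr gauss_I (restrict_space borel X_omega) Psi"
proof -
  have "measure_of X_omega (sets (restrict_space borel X_omega)) (\<lambda>A. emeasure gauss_I (Phi ` A))
    = measure_of X_omega (sets (restrict_space borel X_omega))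
        (\<lambda>A. emeasure gauss_I (Psi -` A \<inter> space gauss_I))"
  proof (rule measure_of_eq)
    show c: "sets (restrict_space borel X_omega) \<subseteq> Pow X_omega"
      using sets.space_closed[of "restrict_space borel X_omega"] by (simp add: space_restrict_space)
    fix A assume "A \<in> sigma_sets X_omega (sets (restrict_space borel X_omega))"
    then have "A \<subseteq> X_omega" using c sigma_sets_into_sp by blast
    then show "emeasure gauss_I (Phi ` A) = emeasure gauss_I (Psi -` A \<inter> space gauss_I)"
      by (simp add: Phi_image)
  qed
  then show ?thesis by (simp add: gamma_omega_def distr_def space_restrict_space)
qed

lemma emeasure_gamma_omega:
  assumes "A \<in> sets (restrict_space borel X_omega)"
  shows "emeasure gamma_omega A = emeasure gauss_I (Phi ` A)"
proof -
  have "A \<subseteq> X_omega"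
    using sets.sets_into_space[OF assms] by (simp add: space_restrict_space)
  then show ?thesis
    unfolding gamma_omega_eq_distr by (simp add: emeasure_distr[OF measurable_Psi assms] Phi_image)
qed

lemma prob_space_gamma_omega: "prob_space gamma_omega"
proof -
  have "prob_space gauss_I"
    unfolding gauss_I_def by (rule prob_space_PiM) (rule prob_space_gauss)
  then show ?thesis
    unfolding gamma_omega_eq_distr by (rule prob_space.prob_space_distr) (rule measurable_Psi)
qed

subsection \<open>The action is well defined\<close>

lemma cyl_val_eq:
  assumes "g \<in> S_level n" "n \<le> length \<sigma>" "extends x \<sigma>"
  shows "cyl_val g \<sigma> = g x"
proof -
  have "g x' = g x" if "extends x' \<sigma>" for x'
  proof -
    have "\<forall>i<n. x' i = x i" using that assms(2,3) by (auto simp: extends_def)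
    with assms(1) show ?thesis by (auto simp: S_level_def)
  qed
  then show ?thesis unfolding cyl_val_def by (intro the_equality) (use assms(3) in blast)+
qed

lemma extends_ex: "\<exists>x. extends x \<sigma>"
  by (rule exI[of _ "\<lambda>i. \<sigma> ! i"]) (simp add: extends_def)

lemma cyl_val_append:
  assumes "g \<in> S_level n" "n \<le> length \<sigma>"
  shows "cyl_val g (\<sigma> @ \<tau>) = cyl_val g \<sigma>"
proof -
  obtain x where x: "extends x (\<sigma> @ \<tau>)" using extends_ex by blast
  then have "extends x \<sigma>" by (auto simp: extends_def nth_append)
  with x show ?thesis using assms cyl_val_eq[of g n] by simp
qed

lemma X_omega_eqI:
  assumes "y \<in> X_omega" "z \<in> X_omega" and eq: "\<And>\<sigma>. N \<le> length \<sigma> \<Longrightarrow> y \<sigma> = z \<sigma>"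
  shows "y = z"
proof
  fix \<sigma>
  have "N \<le> length \<sigma> + d \<Longrightarrow> y \<sigma> = z \<sigma>" for d
  proof (induction d arbitrary: \<sigma>)
    case 0 then show ?case by (simp add: eq)
  next
    case (Suc d)
    have "y (\<sigma> @ [b]) = z (\<sigma> @ [b])" for b using Suc by simp
    moreover have "y \<sigma> = (y (\<sigma> @ [False]) + y (\<sigma> @ [True])) / complex_of_real (sqrt 2)"
      using assms(1) unfolding X_omega_def by blast
    moreover have "z \<sigma> = (z (\<sigma> @ [False]) + z (\<sigma> @ [True])) / complex_of_real (sqrt 2)"
      using assms(2) unfolding X_omega_def by blast
    ultimately show ?case by simp
  qed
  from this[of N] show "y \<sigma> = z \<sigma>" by simp
qed

fun descend :: "nat \<Rightarrow> (bool list \<Rightarrow> complex) \<Rightarrow> bool list \<Rightarrow> complex" where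
  "descend 0 f \<sigma> = f \<sigma>"
| "descend (Suc d) f \<sigma> =
     (descend d f (\<sigma> @ [False]) + descend d f (\<sigma> @ [True])) / complex_of_real (sqrt 2)"

lemma act_exists:
  assumes "g \<in> S_level n" "x \<in> X_omega"
  shows "\<exists>y\<in>X_omega. \<forall>\<sigma>. n \<le> length \<sigma> \<longrightarrow> y \<sigma> = cyl_val g \<sigma> * x \<sigma>"
proof -
  define f where "f \<sigma> = cyl_val g \<sigma> * x \<sigma>" for \<sigma>
  define y where "y \<sigma> = descend (n - length \<sigma>) f \<sigma>" for \<sigma>
  have "y \<sigma> = (y (\<sigma> @ [False]) + y (\<sigma> @ [True])) / complex_of_real (sqrt 2)" for \<sigma>
  proof (cases "n \<le> length \<sigma>")
    case True
    have "x \<sigma> = (x (\<sigma> @ [False]) + x (\<sigma> @ [True])) / complex_of_real (sqrt 2)"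
      using assms(2) unfolding X_omega_def by blast
    then show ?thesis
      using True cyl_val_append[OF assms(1) True] by (simp add: y_def f_def algebra_simps)
  next
    case False
    then have "n - length \<sigma> = Suc (n - Suc (length \<sigma>))" by simp
    then show ?thesis by (simp add: y_def)
  qed
  then have "y \<in> X_omega" unfolding X_omega_def by blast
  moreover have "y \<sigma> = cyl_val g \<sigma> * x \<sigma>" if "n \<le> length \<sigma>" for \<sigma>
    using that by (simp add: y_def f_def)
  ultimately show ?thesis by blast
qed

lemma act_eqI:
  fixes x y :: "bool list \<Rightarrow> complex"
  assumes "g \<in> S_level n" "x \<in> X_omega" "y \<in> X_omega"
    and "\<And>\<sigma> :: bool list. n \<le> length \<sigma> \<Longrightarrow> y \<sigma> = cyl_val g \<sigma> * x \<sigma>"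
  shows "act g x = y"
  unfolding act_def
proof (rule the_equality)
  show "y \<in> X_omega \<and> (\<forall>n. g \<in> S_level n \<longrightarrow> (\<forall>\<sigma>. n \<le> length \<sigma> \<longrightarrow> y \<sigma> = cyl_val g \<sigma> * x \<sigma>))"
  proof (intro conjI allI impI assms(3))
    fix n' and \<sigma> :: "bool list" assume n': "g \<in> S_level n'" "n' \<le> length \<sigma>"
    obtain z where z: "z \<in> X_omega" "\<And>\<sigma>. n' \<le> length \<sigma> \<Longrightarrow> z \<sigma> = cyl_val g \<sigma> * x \<sigma>"
      using act_exists[OF n'(1) assms(2)] by blast
    have "y = z"
    proof (rule X_omega_eqI[where N = "max n n'"])
      fix \<tau> :: "bool list" assume "max n n' \<le> length \<tau>"
      then show "y \<tau> = z \<tau>" using assms(4)[of \<tau>] z(2)[of \<tau>] by simp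
    qed (fact assms(3) z(1))+
    then show "y \<sigma> = cyl_val g \<sigma> * x \<sigma>" using z(2)[OF n'(2)] by simp
  qed
next
  fix z assume z: "z \<in> X_omega \<and> (\<forall>n. g \<in> S_level n \<longrightarrow> (\<forall>\<sigma>. n \<le> length \<sigma> \<longrightarrow> z \<sigma> = cyl_val g \<sigma> * x \<sigma>))"
  show "z = y"
  proof (rule X_omega_eqI[where N = n])
    fix \<tau> :: "bool list" assume "n \<le> length \<tau>"
    then show "z \<tau> = y \<tau>" using assms(1) assms(4)[of \<tau>] z by metis
  qed (use z assms(3) in blast)+
qed

lemma act_spec:
  assumes "g \<in> S_level n" "x \<in> X_omega"
  shows "act g x \<in> X_omega" "n \<le> length \<sigma> \<Longrightarrow> act g x \<sigma> = cyl_val g \<sigma> * x \<sigma>"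
proof -
  obtain y where y: "y \<in> X_omega" "\<And>\<sigma>. n \<le> length \<sigma> \<Longrightarrow> y \<sigma> = cyl_val g \<sigma> * x \<sigma>"
    using act_exists[OF assms] by blast
  then have "act g x = y" by (rule act_eqI[OF assms])
  with y show "act g x \<in> X_omega" "n \<le> length \<sigma> \<Longrightarrow> act g x \<sigma> = cyl_val g \<sigma> * x \<sigma>"
    by simp_all
qed

lemma gs_in_S_level: "gs s k \<in> S_level (Suc k)"
proof -
  have "continuous_on UNIV (\<lambda>x::nat \<Rightarrow> bool. of_bool (x k) :: complex)"
  proof -
    have "continuous_on UNIV (\<lambda>b. of_bool b :: complex)"
      by (rule Topological_Spaces.continuous_on_discrete)
    then show ?thesis
      by (rule continuous_on_compose2) (auto intro: continuous_on_product_coordinates)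
  qed
  moreover have "gs s k = (\<lambda>x. (1 + \<i> * complex_of_real s * (1 - 2 * of_bool (x k)))
      / complex_of_real (sqrt (1 + s\<^sup>2)))"
    by (auto simp: gs_def fun_eq_iff)
  moreover have nz: "sqrt (1 + s\<^sup>2) \<noteq> 0"
    by (metis add_pos_nonneg less_irrefl real_sqrt_eq_zero_cancel_iff zero_le_power2 zero_less_one)
  ultimately have "continuous_on UNIV (gs s k)"
    by (auto intro!: continuous_intros)
  moreover have "norm (gs s k x) = 1" for x
  proof -
    have "cmod (1 + \<i> * complex_of_real s * (- 1) ^ of_bool (x k)) = sqrt (1 + s\<^sup>2)"
      by (cases "x k") (auto simp: cmod_def)
    then show ?thesis using nz by (simp add: gs_def norm_divide)
  qed
  ultimately show ?thesis by (auto simp: S_level_def gs_def)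
qed

end

theory Submission
  imports Defs
begin

text \<open>
  Let \<open>U\<close> be the union of all \<open>g\<^sub>k \<cdot> K\<close>; it suffices that \<open>U\<close> has full measure. With
  \<open>c = 1 / sqrt (1 + s\<^sup>2)\<close>, the element \<open>g\<^sub>k\<inverse> \<cdot> x\<close> agrees with \<open>c (x - \<i> s z\<^sub>k)\<close>
  on all sequences of length at most \<open>k\<close>, where \<open>z\<^sub>k\<close> is built from the Haar coefficients of \<open>x\<close> at level \<open>k\<close> and hence, on these
  sequences, is a copy of \<open>x\<close> independent of it. Since the action preserves the measure, approximation by
  cylinder sets shows that the measure of \<open>B \<inter> g\<^sub>k \<cdot> K\<close> tends to the probability that \<open>x \<in> B\<close>
  and \<open>c (x - \<i> s z) \<in> K\<close> for independent \<open>x\<close>, \<open>z\<close>. This limit is positive whenever \<open>B\<close> and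
  \<open>K\<close> are not null: the set of \<open>x\<close> for which \<open>c (x - \<i> s z) \<in> K\<close> has probability zero is
  invariant under changing finitely many coordinates, so it is null by the zero-one law. The complement
  \<open>B\<close> of \<open>U\<close> is disjoint from every \<open>g\<^sub>k \<cdot> K\<close>, so it is null.
\<close>

subsection \<open>Rotations and the complex Gaussian measure\<close>

lemma nn_integral_lborel_affine:
  fixes f :: "'a::euclidean_space \<Rightarrow> ennreal"
  assumes [measurable]: "f \<in> borel_measurable borel" and "c \<noteq> 0"
  shows "(\<integral>\<^sup>+x. f x \<partial>lborel) = ennreal (\<bar>c\<bar> ^ DIM('a)) * (\<integral>\<^sup>+x. f (t + c *\<^sub>R x) \<partial>lborel)"
  by (subst lborel_affine[OF \<open>c \<noteq> 0\<close>, of t])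
     (simp add: nn_integral_density nn_integral_distr nn_integral_cmult)

text \<open>A rotation of pairs is carried out as two affine substitutions in one variable each,
  with Fubini in between. Their scaling factors \<open>\<bar>1/\<alpha>\<bar> ^ ?d\<close> and
  \<open>\<bar>\<alpha>\<bar> ^ ?d\<close> cancel; the division by \<alpha> rules out a quarter
  turn.\<close>

lemma nn_integral_lborel_rotate:
  fixes F :: "'a::euclidean_space \<times> 'a \<Rightarrow> ennreal"
  assumes F[measurable]: "F \<in> borel_measurable (borel \<Otimes>\<^sub>M borel)"
    and "\<alpha> \<noteq> 0" and eq: "\<alpha>\<^sup>2 + \<beta>\<^sup>2 = 1"
  shows "(\<integral>\<^sup>+x. \<integral>\<^sup>+y. F (\<alpha> *\<^sub>R x + \<beta> *\<^sub>R y, \<alpha> *\<^sub>R y - \<beta> *\<^sub>R x) \<partial>lborel \<partial>lborel)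
    = (\<integral>\<^sup>+x. \<integral>\<^sup>+y. F (x, y) \<partial>lborel \<partial>lborel)" (is "?l = _")
proof -
  let ?d = "DIM('a)"
  have "?l = (\<integral>\<^sup>+y. \<integral>\<^sup>+x. F (\<alpha> *\<^sub>R x + \<beta> *\<^sub>R y, \<alpha> *\<^sub>R y - \<beta> *\<^sub>R x) \<partial>lborel \<partial>lborel)"
    by (rule lborel_pair.Fubini'[symmetric]) measurable
  also have "\<dots> = (\<integral>\<^sup>+y. ennreal (\<bar>1/\<alpha>\<bar> ^ ?d) * (\<integral>\<^sup>+x. F (x, (1/\<alpha>) *\<^sub>R (y - \<beta> *\<^sub>R x)) \<partial>lborel) \<partial>lborel)"
  proof (intro nn_integral_cong)
    fix y :: 'a
    \<comment> \<open>For fixed y the new first component becomes the integration variable;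
      \<open>\<alpha>\<^sup>2 + \<beta>\<^sup>2 = 1\<close> simplifies what the second component
      turns into.\<close>
    have *: "\<alpha> *\<^sub>R (- (\<beta>/\<alpha>) *\<^sub>R y + (1/\<alpha>) *\<^sub>R x) + \<beta> *\<^sub>R y = x"
      "\<alpha> *\<^sub>R y - \<beta> *\<^sub>R (- (\<beta>/\<alpha>) *\<^sub>R y + (1/\<alpha>) *\<^sub>R x) = (1/\<alpha>) *\<^sub>R (y - \<beta> *\<^sub>R x)" for x
    proof -
      show "\<alpha> *\<^sub>R (- (\<beta>/\<alpha>) *\<^sub>R y + (1/\<alpha>) *\<^sub>R x) + \<beta> *\<^sub>R y = x"
        using \<open>\<alpha> \<noteq> 0\<close> by (simp add: algebra_simps)
      have "\<alpha> *\<^sub>R y - \<beta> *\<^sub>R (- (\<beta>/\<alpha>) *\<^sub>R y + (1/\<alpha>) *\<^sub>R x)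
        = (\<alpha> + \<beta>\<^sup>2/\<alpha>) *\<^sub>R y - (\<beta>/\<alpha>) *\<^sub>R x"
        by (simp add: algebra_simps power2_eq_square)
      also have "\<alpha> + \<beta>\<^sup>2/\<alpha> = 1/\<alpha>"
        using \<open>\<alpha> \<noteq> 0\<close> eq by (simp add: field_simps power2_eq_square)
      finally show "\<alpha> *\<^sub>R y - \<beta> *\<^sub>R (- (\<beta>/\<alpha>) *\<^sub>R y + (1/\<alpha>) *\<^sub>R x) = (1/\<alpha>) *\<^sub>R (y - \<beta> *\<^sub>R x)"
        by (simp add: scaleR_diff_right)
    qed
    show "(\<integral>\<^sup>+x. F (\<alpha> *\<^sub>R x + \<beta> *\<^sub>R y, \<alpha> *\<^sub>R y - \<beta> *\<^sub>R x) \<partial>lborel)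
      = ennreal (\<bar>1/\<alpha>\<bar> ^ ?d) * (\<integral>\<^sup>+x. F (x, (1/\<alpha>) *\<^sub>R (y - \<beta> *\<^sub>R x)) \<partial>lborel)"
      by (subst nn_integral_lborel_affine[where c = "1/\<alpha>" and t = "- (\<beta>/\<alpha>) *\<^sub>R y"])
         (measurable, use \<open>\<alpha> \<noteq> 0\<close> in \<open>simp_all only: *, simp_all\<close>)
  qed
  also have "\<dots> = ennreal (\<bar>1/\<alpha>\<bar> ^ ?d) * (\<integral>\<^sup>+y. (\<integral>\<^sup>+x. F (x, (1/\<alpha>) *\<^sub>R (y - \<beta> *\<^sub>R x)) \<partial>lborel) \<partial>lborel)"
    by (rule nn_integral_cmult) measurable
  also have "(\<integral>\<^sup>+y. (\<integral>\<^sup>+x. F (x, (1/\<alpha>) *\<^sub>R (y - \<beta> *\<^sub>R x)) \<partial>lborel) \<partial>lborel)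
    = (\<integral>\<^sup>+x. (\<integral>\<^sup>+y. F (x, (1/\<alpha>) *\<^sub>R (y - \<beta> *\<^sub>R x)) \<partial>lborel) \<partial>lborel)"
    by (rule lborel_pair.Fubini') measurable
  also have "\<dots> = (\<integral>\<^sup>+x. ennreal (\<bar>\<alpha>\<bar> ^ ?d) * (\<integral>\<^sup>+y. F (x, y) \<partial>lborel) \<partial>lborel)"
  proof (intro nn_integral_cong)
    fix x :: 'a
    show "(\<integral>\<^sup>+y. F (x, (1/\<alpha>) *\<^sub>R (y - \<beta> *\<^sub>R x)) \<partial>lborel) = ennreal (\<bar>\<alpha>\<bar> ^ ?d) * (\<integral>\<^sup>+y. F (x, y) \<partial>lborel)"
      by (subst nn_integral_lborel_affine[where c = \<alpha> and t = "\<beta> *\<^sub>R x"])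
         (measurable, use \<open>\<alpha> \<noteq> 0\<close> in simp_all)
  qed
  also have "\<dots> = ennreal (\<bar>\<alpha>\<bar> ^ ?d) * (\<integral>\<^sup>+x. \<integral>\<^sup>+y. F (x, y) \<partial>lborel \<partial>lborel)"
    by (rule nn_integral_cmult) measurable
  also have "ennreal (\<bar>1/\<alpha>\<bar> ^ ?d) * (ennreal (\<bar>\<alpha>\<bar> ^ ?d) * (\<integral>\<^sup>+x. \<integral>\<^sup>+y. F (x, y) \<partial>lborel \<partial>lborel))
    = (\<integral>\<^sup>+x. \<integral>\<^sup>+y. F (x, y) \<partial>lborel \<partial>lborel)"
    using \<open>\<alpha> \<noteq> 0\<close> by (simp flip: mult.assoc ennreal_mult power_mult_distrib)
  finally show ?thesis .
qed

section \<open>Lebesgue and Gaussian measure on the complex plane\<close>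

lemma measurable_Complex [measurable]:
  "(\<lambda>(x, y). Complex x y) \<in> borel_measurable (borel \<Otimes>\<^sub>M borel)"
  by (intro borel_measurable_complex_iff[THEN iffD2] conjI) (auto simp: case_prod_beta)

lemma lborel_complex_eq_distr:
  "(lborel :: complex measure) = distr (lborel \<Otimes>\<^sub>M lborel) borel (\<lambda>(x, y). Complex x y)"
proof (rule lborel_eqI)
  fix l u :: complex assume le: "\<And>b. b \<in> Basis \<Longrightarrow> l \<bullet> b \<le> u \<bullet> b"
  have "(\<lambda>(x, y). Complex x y) -` box l u = {Re l<..<Re u} \<times> {Im l<..<Im u}"
    by (auto simp: box_def Basis_complex_def inner_complex_def)
  moreover have "Re l \<le> Re u" "Im l \<le> Im u"
    using le[of 1] le[of \<i>] by (auto simp: Basis_complex_def inner_complex_def)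
  ultimately show "emeasure (distr (lborel \<Otimes>\<^sub>M lborel) borel (\<lambda>(x, y). Complex x y)) (box l u)
    = (\<Prod>b\<in>Basis. (u - l) \<bullet> b)"
    by (simp add: emeasure_distr space_pair_measure lborel.emeasure_pair_measure_Times
      Basis_complex_def inner_complex_def ennreal_mult)
qed simp

lemma nn_integral_lborel_complex:
  assumes [measurable]: "f \<in> borel_measurable borel"
  shows "(\<integral>\<^sup>+z. f z \<partial>lborel) = (\<integral>\<^sup>+x. \<integral>\<^sup>+y. f (Complex x y) \<partial>lborel \<partial>lborel)"
proof -
  show ?thesis
    by (subst lborel_complex_eq_distr, subst nn_integral_distr)
       (measurable, simp add: lborel.nn_integral_fst[symmetric] case_prod_beta)
qed

text \<open>Multiplication by u is the planar rotation with coefficients \<open>Re u\<close> and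
  \<open>- Im u\<close>, which settles \<open>Re u \<noteq> 0\<close>. The remaining values i and -i
  are products of two unit numbers with nonzero real part.\<close>

lemma nn_integral_lborel_rotate_complex:
  assumes f[measurable]: "f \<in> borel_measurable borel" and u: "norm u = 1"
  shows "(\<integral>\<^sup>+z. f (u * z) \<partial>lborel) = (\<integral>\<^sup>+z. f z \<partial>(lborel :: complex measure))"
proof -
  have *: "(\<integral>\<^sup>+z. f (u * z) \<partial>lborel) = (\<integral>\<^sup>+z. f z \<partial>(lborel :: complex measure))"
    if [measurable]: "f \<in> borel_measurable borel" and u: "norm u = 1" "Re u \<noteq> 0" for f and u :: complex
  proof -
    have "(\<integral>\<^sup>+z. f (u * z) \<partial>lborel) = (\<integral>\<^sup>+x. \<integral>\<^sup>+y. (f \<circ> (\<lambda>(x, y). Complex x y))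
        (Re u *\<^sub>R x + (- Im u) *\<^sub>R y, Re u *\<^sub>R y - (- Im u) *\<^sub>R x) \<partial>lborel \<partial>lborel)"
      by (subst nn_integral_lborel_complex) (auto intro!: nn_integral_cong arg_cong[where f = f] simp: complex_eq_iff)
    also have "\<dots> = (\<integral>\<^sup>+x. \<integral>\<^sup>+y. (f \<circ> (\<lambda>(x, y). Complex x y)) (x, y) \<partial>lborel \<partial>lborel)"
      by (rule nn_integral_lborel_rotate)
         (use u in \<open>auto simp: cmod_def comp_def\<close>)
    finally show ?thesis by (simp add: nn_integral_lborel_complex)
  qed
  show ?thesis
  proof (cases "Re u = 0")
    case False
    with * u show ?thesis by simp
  next
    case True
    \<comment> \<open>An eighth root of unity: turning u back by 45 degrees moves it off the
      imaginary axis.\<close>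
    define w where "w = Complex (1 / sqrt 2) (1 / sqrt 2)"
    define v where "v = u * cnj w"
    have w: "norm w = 1" "Re w \<noteq> 0"
      by (auto simp: w_def cmod_def power_divide)
    have "Im u \<noteq> 0" using u True by (auto simp: cmod_def)
    then have v: "norm v = 1" "Re v \<noteq> 0"
      using u w True by (simp_all add: v_def norm_mult, simp add: w_def)
    have "v * (w * z) = u * z" for z
      using w complex_norm_square[of w] by (simp add: v_def mult_ac)
    then have "(\<integral>\<^sup>+z. f (u * z) \<partial>lborel) = (\<integral>\<^sup>+z. f (v * (w * z)) \<partial>lborel)"
      by (simp only:)
    also have "\<dots> = (\<integral>\<^sup>+z. f (v * z) \<partial>lborel)" by (rule *) (use w in auto)
    also have "\<dots> = (\<integral>\<^sup>+z. f z \<partial>lborel)" by (rule *) (use v in auto)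
    finally show ?thesis .
  qed
qed

lemma nn_integral_gauss:
  assumes [measurable]: "f \<in> borel_measurable borel"
  shows "(\<integral>\<^sup>+z. f z \<partial>gauss) = (\<integral>\<^sup>+z. ennreal (1 / (2 * pi) * exp (- (norm z)\<^sup>2 / 2)) * f z \<partial>lborel)"
  unfolding gauss_def by (subst nn_integral_density) (auto simp: cmod_power2)

lemma nn_integral_gauss_unit:
  assumes [measurable]: "f \<in> borel_measurable borel" and u: "norm u = 1"
  shows "(\<integral>\<^sup>+z. f (u * z) \<partial>gauss) = (\<integral>\<^sup>+z. f z \<partial>gauss)"
  using nn_integral_lborel_rotate_complex[of "\<lambda>z. ennreal (1 / (2 * pi) * exp (- (norm z)\<^sup>2 / 2)) * f z" u] u
  by (simp add: nn_integral_gauss norm_mult)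

interpretation gauss: prob_space gauss by (rule prob_space_gauss)

text \<open>The joint density depends on the pair only through
  \<open>(norm x)\<^sup>2 + (norm y)\<^sup>2\<close>, which the rotation fixes, so the claim reduces
  to Lebesgue measure.\<close>

lemma nn_integral_gauss_rotate:
  assumes F[measurable]: "F \<in> borel_measurable (borel \<Otimes>\<^sub>M borel)"
    and "\<alpha> \<noteq> 0" and eq: "\<alpha>\<^sup>2 + \<beta>\<^sup>2 = 1"
  shows "(\<integral>\<^sup>+x. \<integral>\<^sup>+y. F (\<alpha> *\<^sub>R x + \<beta> *\<^sub>R y, \<alpha> *\<^sub>R y - \<beta> *\<^sub>R x) \<partial>gauss \<partial>gauss)
    = (\<integral>\<^sup>+x. \<integral>\<^sup>+y. F (x, y) \<partial>gauss \<partial>gauss)"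
proof -
  let ?h = "\<lambda>z. ennreal (1 / (2 * pi) * exp (- (norm z)\<^sup>2 / 2))"
  define H where "H p = ?h (fst p) * ?h (snd p)" for p :: "complex \<times> complex"
  have [measurable]: "H \<in> borel_measurable (borel \<Otimes>\<^sub>M borel)"
    unfolding H_def by measurable
  have gen: "(\<integral>\<^sup>+x. \<integral>\<^sup>+y. G x y \<partial>gauss \<partial>gauss) = (\<integral>\<^sup>+x. \<integral>\<^sup>+y. H (x, y) * G x y \<partial>lborel \<partial>lborel)"
    if [measurable]: "(\<lambda>(x, y). G x y) \<in> borel_measurable (borel \<Otimes>\<^sub>M borel)" for G
  proof -
    have [measurable]: "(\<lambda>(x, y). G x y) \<in> borel_measurable (borel \<Otimes>\<^sub>M gauss)"
      using that measurable_cong_sets[OF sets_pair_measure_cong[OF refl sets_gauss] refl] by blast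
    show ?thesis
      by (simp add: nn_integral_gauss nn_integral_cmult H_def mult.assoc)
  qed
  have norms: "(norm (\<alpha> *\<^sub>R x + \<beta> *\<^sub>R y))\<^sup>2 + (norm (\<alpha> *\<^sub>R y - \<beta> *\<^sub>R x))\<^sup>2 = (norm x)\<^sup>2 + (norm y)\<^sup>2"
    for x y :: complex
  proof -
    have "(norm (\<alpha> *\<^sub>R x + \<beta> *\<^sub>R y))\<^sup>2 + (norm (\<alpha> *\<^sub>R y - \<beta> *\<^sub>R x))\<^sup>2
      = (\<alpha>\<^sup>2 + \<beta>\<^sup>2) * ((norm x)\<^sup>2 + (norm y)\<^sup>2)"
      by (simp only: cmod_power2, simp add: power2_eq_square algebra_simps)
    then show ?thesis by (simp add: eq)
  qed
  have Hn: "H p = ennreal (1 / (2 * pi)\<^sup>2 * exp (- ((norm (fst p))\<^sup>2 + (norm (snd p))\<^sup>2) / 2))" for p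
    by (simp add: H_def power2_eq_square add_divide_distrib flip: ennreal_mult exp_add)
  have "H (x, y) = H (\<alpha> *\<^sub>R x + \<beta> *\<^sub>R y, \<alpha> *\<^sub>R y - \<beta> *\<^sub>R x)" for x y
    by (simp only: Hn fst_conv snd_conv norms)
  then have "(\<integral>\<^sup>+x. \<integral>\<^sup>+y. F (\<alpha> *\<^sub>R x + \<beta> *\<^sub>R y, \<alpha> *\<^sub>R y - \<beta> *\<^sub>R x) \<partial>gauss \<partial>gauss)
    = (\<integral>\<^sup>+x. \<integral>\<^sup>+y. (\<lambda>p. H p * F p) (\<alpha> *\<^sub>R x + \<beta> *\<^sub>R y, \<alpha> *\<^sub>R y - \<beta> *\<^sub>R x) \<partial>lborel \<partial>lborel)"
    by (subst gen) auto
  also have "\<dots> = (\<integral>\<^sup>+x. \<integral>\<^sup>+y. (\<lambda>p. H p * F p) (x, y) \<partial>lborel \<partial>lborel)"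
    by (rule nn_integral_lborel_rotate) (use assms in auto)
  also have "\<dots> = (\<integral>\<^sup>+x. \<integral>\<^sup>+y. F (x, y) \<partial>gauss \<partial>gauss)"
    by (subst gen) auto
  finally show ?thesis .
qed

text \<open>One coordinate of the limiting law of \<open>g\<^sub>k\<inverse> \<cdot> x\<close>.\<close>

definition mix :: "real \<Rightarrow> complex \<Rightarrow> complex \<Rightarrow> complex" where
  "mix s a b = (a - \<i> * complex_of_real s * b) / complex_of_real (sqrt (1 + s\<^sup>2))"

abbreviation mixes :: "real \<Rightarrow> ('i \<Rightarrow> complex) \<Rightarrow> ('i \<Rightarrow> complex) \<Rightarrow> 'i \<Rightarrow> complex" where
  "mixes s y z \<equiv> \<lambda>i. mix s (y i) (z i)"

lemma measurable_mix [measurable]: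
  assumes [measurable]: "f \<in> borel_measurable M" "g \<in> borel_measurable M"
  shows "(\<lambda>x. mix s (f x) (g x)) \<in> borel_measurable M"
  unfolding mix_def by measurable

text \<open>A factor i in the second argument, harmless for a Gaussian variable, turns
  \<open>mix\<close> into the first component of a real rotation of the pair.\<close>

lemma mix_ii:
  "mix s x (\<i> * y) = (1 / sqrt (1 + s\<^sup>2)) *\<^sub>R x + (1 / sqrt (1 + s\<^sup>2) * s) *\<^sub>R y"
proof -
  have "x - \<i> * complex_of_real s * (\<i> * y) = x + complex_of_real s * y"
    by (simp add: complex_eq_iff)
  then show ?thesis
    unfolding mix_def by (simp only:) (simp add: scaleR_conv_of_real add_divide_distrib)
qed

text \<open>Once y is multiplied by i, \<open>mix\<close> is one component of a rotated independent
  pair, and f reads only that component.\<close>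

lemma nn_integral_gauss_mix:
  assumes [measurable]: "f \<in> borel_measurable borel"
  shows "(\<integral>\<^sup>+x. \<integral>\<^sup>+y. f (mix s x y) \<partial>gauss \<partial>gauss) = (\<integral>\<^sup>+x. f x \<partial>gauss)"
proof -
  define c where "c = 1 / sqrt (1 + s\<^sup>2)"
  have p: "0 < 1 + s\<^sup>2" by (simp add: add_pos_nonneg)
  have "c \<noteq> 0" "c\<^sup>2 + (c * s)\<^sup>2 = 1"
    using p by (auto simp: c_def power_divide power_mult_distrib field_simps)
  have "mix s x (\<i> * y) = c *\<^sub>R x + (c * s) *\<^sub>R y" for x y
    by (simp only: mix_ii c_def)
  then have "(\<integral>\<^sup>+x. \<integral>\<^sup>+y. f (mix s x y) \<partial>gauss \<partial>gauss)
    = (\<integral>\<^sup>+x. \<integral>\<^sup>+y. f (c *\<^sub>R x + (c * s) *\<^sub>R y) \<partial>gauss \<partial>gauss)"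
    using nn_integral_gauss_unit[of "\<lambda>y. f (mix s x y)" \<i> for x] by simp
  also have "\<dots> = (\<integral>\<^sup>+x. \<integral>\<^sup>+y. (\<lambda>p. f (fst p)) (c *\<^sub>R x + (c * s) *\<^sub>R y, c *\<^sub>R y - (c * s) *\<^sub>R x) \<partial>gauss \<partial>gauss)"
    by simp
  also have "\<dots> = (\<integral>\<^sup>+x. \<integral>\<^sup>+y. (\<lambda>p. f (fst p)) (x, y) \<partial>gauss \<partial>gauss)"
    by (rule nn_integral_gauss_rotate) (measurable, fact+)
  finally show ?thesis by (simp add: gauss.emeasure_space_1)
qed

text \<open>The Gaussian density is positive everywhere, so its null sets are those of Lebesgue
  measure, and for nonzero s the second argument enters \<open>mix\<close> through an affine
  bijection of the plane. The translation by a multiple of x does not affect null sets.\<close>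

lemma nn_integral_gauss_mix_eq_0:
  assumes [measurable]: "f \<in> borel_measurable borel" and "s \<noteq> 0"
  shows "(\<integral>\<^sup>+y. f (mix s x y) \<partial>gauss) = 0 \<longleftrightarrow> (\<integral>\<^sup>+y. f y \<partial>lborel) = 0"
proof -
  define c where "c = 1 / sqrt (1 + s\<^sup>2)"
  have p: "0 < 1 + s\<^sup>2" by (simp add: add_pos_nonneg)
  have c: "c * s \<noteq> 0" using p \<open>s \<noteq> 0\<close> by (simp add: c_def)
  have "(\<integral>\<^sup>+y. f (mix s x y) \<partial>gauss) = 0
    \<longleftrightarrow> (AE y in lborel. ennreal (1 / (2 * pi) * exp (- (norm y)\<^sup>2 / 2)) * f (mix s x y) = 0)"
    by (subst nn_integral_gauss) (auto simp: nn_integral_0_iff_AE)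
  also have "\<dots> \<longleftrightarrow> (AE y in lborel. f (mix s x y) = 0)"
    by (simp add: ennreal_eq_0_iff not_le divide_simps)
  also have "\<dots> \<longleftrightarrow> (\<integral>\<^sup>+y. f (mix s x y) \<partial>lborel) = 0"
    by (simp add: nn_integral_0_iff_AE)
  also have "(\<integral>\<^sup>+y. f (mix s x y) \<partial>lborel) = (\<integral>\<^sup>+y. f (mix s x (\<i> * y)) \<partial>lborel)"
    by (subst nn_integral_lborel_rotate_complex) simp_all
  also have "mix s x (\<i> * y) = c *\<^sub>R x + (c * s) *\<^sub>R y" for y
    by (simp only: mix_ii c_def)
  then have "(\<integral>\<^sup>+y. f (mix s x (\<i> * y)) \<partial>lborel) = 0 \<longleftrightarrow> (\<integral>\<^sup>+y. f y \<partial>lborel) = 0"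
    using nn_integral_lborel_affine[of f "c * s" "c *\<^sub>R x"] c by simp
  finally show ?thesis .
qed

subsection \<open>Independent copies and level marginals\<close>

interpretation gauss_I: prob_space gauss_I
  unfolding gauss_I_def by (rule prob_space_PiM) (rule prob_space_gauss)

interpretation gauss_II: pair_prob_space gauss_I gauss_I ..

interpretation gauss_prod: product_prob_space "\<lambda>_ :: bool list option. gauss" UNIV
  by (rule product_prob_spaceI) (rule prob_space_gauss)

lemma space_gauss [simp]: "space gauss = UNIV"
  by (simp add: gauss_def)

lemma emeasure_gauss_UNIV [simp]: "emeasure gauss UNIV = 1" "emeasure gauss_I UNIV = 1"
  using gauss.emeasure_space_1 gauss_I.emeasure_space_1 by simp_all

lemma sets_gauss_I [measurable_cong]: "sets gauss_I = sets (PiM UNIV (\<lambda>_. borel))"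
  unfolding gauss_I_def by (rule sets_PiM_cong) simp_all

lemma measurable_coord [measurable]: "(\<lambda>y. y i) \<in> borel_measurable gauss_I"
  unfolding gauss_I_def by measurable

lemma measurable_gauss_I_coordwise:
  assumes "\<And>i. (\<lambda>x. f x i) \<in> borel_measurable M"
  shows "f \<in> M \<rightarrow>\<^sub>M gauss_I"
proof -
  have "f \<in> M \<rightarrow>\<^sub>M PiM UNIV (\<lambda>_. borel)"
    using assms by (intro measurable_PiM_single') auto
  then show ?thesis using measurable_cong_sets[OF refl sets_gauss_I] by blast
qed

lemma measurable_mixes [measurable]:
  assumes [measurable]: "f \<in> M \<rightarrow>\<^sub>M gauss_I" "g \<in> M \<rightarrow>\<^sub>M gauss_I"
  shows "(\<lambda>x. mixes s (f x) (g x)) \<in> M \<rightarrow>\<^sub>M gauss_I"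
proof (rule measurable_gauss_I_coordwise)
  fix i
  have "(\<lambda>x. f x i) \<in> borel_measurable M" "(\<lambda>x. g x i) \<in> borel_measurable M"
    by (rule measurable_compose[OF _ measurable_coord], fact)+
  then show "(\<lambda>x. mix s (f x i) (g x i)) \<in> borel_measurable M" by measurable
qed

text \<open>The integrand sees only the coordinates in J, so the integral passes to the finite
  product measure, where it factors.\<close>

lemma nn_integral_gauss_I_prod:
  assumes "finite J" and [measurable]: "\<And>i. f i \<in> borel_measurable borel"
  shows "(\<integral>\<^sup>+y. (\<Prod>i\<in>J. f i (y i)) \<partial>gauss_I) = (\<Prod>i\<in>J. \<integral>\<^sup>+a. f i a \<partial>gauss)"
proof -
  have "(\<Prod>i\<in>J. \<integral>\<^sup>+a. f i a \<partial>gauss) = (\<integral>\<^sup>+v. (\<Prod>i\<in>J. f i (v i)) \<partial>PiM J (\<lambda>_. gauss))"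
    by (rule gauss_prod.product_nn_integral_prod[symmetric])
      (use assms in \<open>auto simp: measurable_cong_sets[OF sets_gauss refl]\<close>)
  also have "PiM J (\<lambda>_. gauss) = distr gauss_I (PiM J (\<lambda>_. gauss)) (\<lambda>y. restrict y J)"
    unfolding gauss_I_def by (rule gauss_prod.distr_PiM_restrict_finite[symmetric]) (use assms in auto)
  also have "(\<integral>\<^sup>+v. (\<Prod>i\<in>J. f i (v i)) \<partial>\<dots>) = (\<integral>\<^sup>+y. (\<Prod>i\<in>J. f i (restrict y J i)) \<partial>gauss_I)"
  proof (rule nn_integral_distr)
    show "(\<lambda>y. restrict y J) \<in> gauss_I \<rightarrow>\<^sub>M PiM J (\<lambda>_. gauss)"
      unfolding gauss_I_def by (rule measurable_restrict_subset) simp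
    have "(\<lambda>v. f i (v i)) \<in> borel_measurable (PiM J (\<lambda>_. gauss))" if "i \<in> J" for i
      by (rule measurable_compose[OF measurable_component_singleton[OF that]])
        (simp add: measurable_cong_sets[OF sets_gauss refl])
    then show "(\<lambda>v. \<Prod>i\<in>J. f i (v i)) \<in> borel_measurable
        (distr gauss_I (PiM J (\<lambda>_. gauss)) (\<lambda>y. restrict y J))"
      by (simp add: borel_measurable_prod_ennreal)
  qed
  also have "\<dots> = (\<integral>\<^sup>+y. (\<Prod>i\<in>J. f i (y i)) \<partial>gauss_I)"
    by (intro nn_integral_cong prod.cong) auto
  finally show ?thesis by simp
qed

text \<open>Serves both for splicing and for mixing two independent copies. A measure on the
  infinite product is determined by boxes in finitely many coordinates, and on a box the double
  integral factors into the assumed one-coordinate laws.\<close>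

lemma nn_integral_coordwise:
  fixes \<phi> :: "bool list option \<Rightarrow> complex \<times> complex \<Rightarrow> complex"
  assumes \<phi>[measurable]: "\<And>i. \<phi> i \<in> borel_measurable (borel \<Otimes>\<^sub>M borel)"
    and law: "\<And>i A. A \<in> sets borel \<Longrightarrow>
      (\<integral>\<^sup>+a. \<integral>\<^sup>+b. indicator A (\<phi> i (a, b)) \<partial>gauss \<partial>gauss) = emeasure gauss A"
    and F[measurable]: "F \<in> borel_measurable gauss_I"
  shows "(\<integral>\<^sup>+x. \<integral>\<^sup>+z. F (\<lambda>i. \<phi> i (x i, z i)) \<partial>gauss_I \<partial>gauss_I) = (\<integral>\<^sup>+y. F y \<partial>gauss_I)"
proof -
  let ?h = "\<lambda>p i. \<phi> i (fst p i, snd p i)"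
  have [measurable]: "?h \<in> gauss_I \<Otimes>\<^sub>M gauss_I \<rightarrow>\<^sub>M gauss_I"
    by (rule measurable_gauss_I_coordwise) measurable
  have "gauss_I = distr (gauss_I \<Otimes>\<^sub>M gauss_I) gauss_I ?h"
  proof (rule measure_eqI_PiM_infinite[where I = UNIV and M = "\<lambda>_. gauss"])
    fix A and J :: "bool list option set"
    assume J: "finite J" and A0: "\<And>i. i \<in> J \<Longrightarrow> A i \<in> sets gauss"
    \<comment> \<open>Nothing is known of A off J; the empty set there makes every
      \<open>A' i\<close> Borel, as the product lemma asks for all indices.\<close>
    define A' where "A' i = (if i \<in> J then A i else {})" for i
    have A[measurable]: "A' i \<in> sets borel" for i
      using A0 by (auto simp: A'_def)
    let ?E = "prod_emb UNIV (\<lambda>_. gauss) J (Pi\<^sub>E J A)"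
    have E: "?E = {y. \<forall>i\<in>J. y i \<in> A' i}"
      by (auto simp: prod_emb_def A'_def PiE_iff)
    have [measurable]: "?E \<in> sets gauss_I"
      unfolding gauss_I_def using J A0 by (intro sets_PiM_I) auto
    have ind: "indicator ?E y = (\<Prod>i\<in>J. indicator (A' i) (y i) :: ennreal)" for y
      unfolding E using J by (induction J) (auto simp: indicator_def)
    have "emeasure (distr (gauss_I \<Otimes>\<^sub>M gauss_I) gauss_I ?h) ?E
      = (\<integral>\<^sup>+y. indicator ?E y \<partial>distr (gauss_I \<Otimes>\<^sub>M gauss_I) gauss_I ?h)"
      by simp
    also have "\<dots> = (\<integral>\<^sup>+p. indicator ?E (?h p) \<partial>(gauss_I \<Otimes>\<^sub>M gauss_I))"
      by (rule nn_integral_distr) measurable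
    also have "\<dots> = (\<integral>\<^sup>+x. \<integral>\<^sup>+z. (\<Prod>i\<in>J. indicator (A' i) (\<phi> i (x i, z i))) \<partial>gauss_I \<partial>gauss_I)"
      by (simp add: gauss_I.nn_integral_fst[symmetric] ind)
    also have "\<dots> = (\<integral>\<^sup>+x. (\<Prod>i\<in>J. \<integral>\<^sup>+b. indicator (A' i) (\<phi> i (x i, b)) \<partial>gauss) \<partial>gauss_I)"
      by (intro nn_integral_cong nn_integral_gauss_I_prod J) measurable
    also have "\<dots> = (\<Prod>i\<in>J. \<integral>\<^sup>+a. \<integral>\<^sup>+b. indicator (A' i) (\<phi> i (a, b)) \<partial>gauss \<partial>gauss)"
      by (intro nn_integral_gauss_I_prod J) measurable
    also have "\<dots> = (\<Prod>i\<in>J. emeasure gauss (A' i))"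
      by (simp add: law)
    also have "\<dots> = (\<integral>\<^sup>+y. (\<Prod>i\<in>J. indicator (A' i) (y i)) \<partial>gauss_I)"
      by (subst nn_integral_gauss_I_prod[OF J]) auto
    also have "\<dots> = emeasure gauss_I ?E"
      by (simp flip: ind)
    finally show "emeasure gauss_I ?E = emeasure (distr (gauss_I \<Otimes>\<^sub>M gauss_I) gauss_I ?h) ?E" ..
  qed (auto simp: gauss_I_def[symmetric], unfold_locales)
  then have "(\<integral>\<^sup>+y. F y \<partial>gauss_I) = (\<integral>\<^sup>+y. F y \<partial>distr (gauss_I \<Otimes>\<^sub>M gauss_I) gauss_I ?h)"
    by simp
  also have "\<dots> = (\<integral>\<^sup>+p. F (?h p) \<partial>(gauss_I \<Otimes>\<^sub>M gauss_I))"
    by (rule nn_integral_distr) auto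
  also have "\<dots> = (\<integral>\<^sup>+x. \<integral>\<^sup>+z. F (\<lambda>i. \<phi> i (x i, z i)) \<partial>gauss_I \<partial>gauss_I)"
    by (simp add: gauss_I.nn_integral_fst[symmetric])
  finally show ?thesis ..
qed

text \<open>Takes the place of conditioning on the coordinates in J: the inner integral resamples
  all the others independently.\<close>

lemma nn_integral_merge:
  assumes "F \<in> borel_measurable gauss_I"
  shows "(\<integral>\<^sup>+x. \<integral>\<^sup>+z. F (\<lambda>i. if i \<in> J then x i else z i) \<partial>gauss_I \<partial>gauss_I) = (\<integral>\<^sup>+y. F y \<partial>gauss_I)"
proof -
  have "(\<integral>\<^sup>+a. \<integral>\<^sup>+b. indicator A (if i \<in> J then a else b) \<partial>gauss \<partial>gauss) = emeasure gauss A"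
    if "A \<in> sets borel" for i A
    using that by (cases "i \<in> J") simp_all
  then show ?thesis
    using nn_integral_coordwise[of "\<lambda>i p. if i \<in> J then fst p else snd p" F] assms
    by (simp cong: if_cong)
qed

lemma nn_integral_mix:
  assumes "F \<in> borel_measurable gauss_I"
  shows "(\<integral>\<^sup>+x. \<integral>\<^sup>+z. F (mixes s x z) \<partial>gauss_I \<partial>gauss_I) = (\<integral>\<^sup>+y. F y \<partial>gauss_I)"
  using nn_integral_coordwise[of "\<lambda>i p. mix s (fst p) (snd p)" F] assms
    nn_integral_gauss_mix[of "indicator A" s for A]
  by simp

section \<open>Values of \<open>Psi\<close> on sequences of one length\<close>

lemma Psi_Nil [simp]: "Psi y [] = y None"
  by (simp add: Psi_def)

lemma Psi_snoc:
  "Psi y (\<sigma> @ [b]) = (Psi y \<sigma> + (if b then - y (Some \<sigma>) else y (Some \<sigma>))) / complex_of_real (sqrt 2)"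
  by (simp add: Psi_def)

lemma measurable_Psi_coord [measurable]: "(\<lambda>y. Psi y \<sigma>) \<in> borel_measurable gauss_I"
  by (induction \<sigma> rule: rev_induct) (simp_all add: Psi_snoc)

text \<open>These coordinates determine \<open>Psi y\<close> on the sequences of length k and are
  recovered from it by \<open>haar\<close> below. There are 2^k of them, as many as such
  sequences.\<close>

definition coords_below :: "nat \<Rightarrow> bool list option set" where
  "coords_below k = insert None (Some ` {\<sigma>. length \<sigma> < k})"

lemma coords_below_simps [simp]:
  "None \<in> coords_below k" "Some \<sigma> \<in> coords_below k \<longleftrightarrow> length \<sigma> < k"
  by (auto simp: coords_below_def)

abbreviation level :: "nat \<Rightarrow> bool list set" where
  "level k \<equiv> {\<sigma>. length \<sigma> = k}"

lemma finite_level [simp]: "finite (level k)"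
  using finite_lists_length_eq[of "UNIV :: bool set" k] by simp

lemma finite_coords_below [simp]: "finite (coords_below k)"
proof -
  have "{\<sigma> :: bool list. length \<sigma> < k} = (\<Union>j<k. level j)" by auto
  then show ?thesis by (simp add: coords_below_def)
qed

lemma coords_below_mono: "j \<le> k \<Longrightarrow> coords_below j \<subseteq> coords_below k"
  by (auto simp: coords_below_def)

lemma Psi_cong: "(\<And>i. i \<in> coords_below (length \<sigma>) \<Longrightarrow> y i = y' i) \<Longrightarrow> Psi y \<sigma> = Psi y' \<sigma>"
proof (induction \<sigma> rule: rev_induct)
  case (snoc b \<sigma>)
  have "Psi y \<sigma> = Psi y' \<sigma>"
    using snoc coords_below_mono[of "length \<sigma>" "Suc (length \<sigma>)"] by fastforce
  with snoc.prems[of "Some \<sigma>"] show ?case by (simp add: Psi_snoc)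
qed simp

lemma prod_level_Suc:
  "(\<Prod>\<sigma>\<in>level (Suc k). h \<sigma>) = (\<Prod>\<sigma>\<in>level k. h (\<sigma> @ [False]) * h (\<sigma> @ [True]))"
proof -
  have e: "level (Suc k) = (\<lambda>\<sigma>. \<sigma> @ [False]) ` level k \<union> (\<lambda>\<sigma>. \<sigma> @ [True]) ` level k"
  proof (intro set_eqI iffI)
    fix \<tau> assume "\<tau> \<in> level (Suc k)"
    then obtain \<sigma> b where "\<tau> = \<sigma> @ [b]" "length \<sigma> = k"
      by (cases \<tau> rule: rev_cases) auto
    then show "\<tau> \<in> (\<lambda>\<sigma>. \<sigma> @ [False]) ` level k \<union> (\<lambda>\<sigma>. \<sigma> @ [True]) ` level k"
      by (cases b) auto
  qed auto
  show ?thesis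
    unfolding e by (subst prod.union_disjoint) (auto simp: prod.reindex inj_on_def prod.distrib)
qed

lemma nn_integral_level_prod:
  assumes [measurable]: "\<And>\<sigma>. g \<sigma> \<in> borel_measurable borel"
  shows "(\<integral>\<^sup>+y. (\<Prod>\<sigma>\<in>level k. g \<sigma> (y (Some \<sigma>))) \<partial>gauss_I) = (\<Prod>\<sigma>\<in>level k. \<integral>\<^sup>+a. g \<sigma> a \<partial>gauss)"
  using nn_integral_gauss_I_prod[of "Some ` level k" "\<lambda>i. g (the i)"]
  by (simp add: prod.reindex)

text \<open>If a is the value at a node and b its Haar coefficient, the arguments of f and g are the
  values at the two children. Up to a sign they form a rotation of (a, b) by 45 degrees, hence are
  again independent standard Gaussians.\<close>

lemma nn_integral_gauss_split:
  assumes [measurable]: "f \<in> borel_measurable borel" "g \<in> borel_measurable borel"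
  shows "(\<integral>\<^sup>+a. \<integral>\<^sup>+b. f ((a + b) / complex_of_real (sqrt 2)) * g ((a - b) / complex_of_real (sqrt 2)) \<partial>gauss \<partial>gauss)
    = (\<integral>\<^sup>+a. f a \<partial>gauss) * (\<integral>\<^sup>+a. g a \<partial>gauss)"
proof -
  \<comment> \<open>The rotation has second component (b - a) / sqrt 2; the minus sign corrects this
    and is absorbed by the symmetry of the Gaussian law.\<close>
  let ?F = "\<lambda>p. f (fst p) * g (- snd p)"
  have "(\<integral>\<^sup>+a. \<integral>\<^sup>+b. f ((a + b) / complex_of_real (sqrt 2)) * g ((a - b) / complex_of_real (sqrt 2)) \<partial>gauss \<partial>gauss)
    = (\<integral>\<^sup>+a. \<integral>\<^sup>+b. ?F ((1 / sqrt 2) *\<^sub>R a + (1 / sqrt 2) *\<^sub>R b, (1 / sqrt 2) *\<^sub>R b - (1 / sqrt 2) *\<^sub>R a)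
        \<partial>gauss \<partial>gauss)"
    by (simp add: scaleR_conv_of_real add_divide_distrib diff_divide_distrib)
  also have "\<dots> = (\<integral>\<^sup>+a. \<integral>\<^sup>+b. ?F (a, b) \<partial>gauss \<partial>gauss)"
    by (rule nn_integral_gauss_rotate) (auto simp: power_divide)
  also have "\<dots> = (\<integral>\<^sup>+a. f a \<partial>gauss) * (\<integral>\<^sup>+b. g (- b) \<partial>gauss)"
  proof -
    have "(\<integral>\<^sup>+b. f a * g (- b) \<partial>gauss) = f a * (\<integral>\<^sup>+b. g (- b) \<partial>gauss)" for a
      by (rule nn_integral_cmult) (simp add: measurable_cong_sets[OF sets_gauss refl])
    moreover have "f \<in> borel_measurable gauss"
      by (simp add: measurable_cong_sets[OF sets_gauss refl])
    ultimately show ?thesis by (simp add: nn_integral_multc)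
  qed
  also have "(\<integral>\<^sup>+b. g (- b) \<partial>gauss) = (\<integral>\<^sup>+b. g b \<partial>gauss)"
    using nn_integral_gauss_unit[of g "-1"] by simp
  finally show ?thesis .
qed

text \<open>Although the values \<open>Psi y \<sigma>\<close> share coordinates, those at one length
  are independent standard Gaussians. By induction on the length, each value is split by a fresh
  coordinate into two independent ones.\<close>

lemma nn_integral_level_prod_Psi:
  assumes [measurable]: "\<And>\<sigma>. g \<sigma> \<in> borel_measurable borel"
  shows "(\<integral>\<^sup>+y. (\<Prod>\<sigma>\<in>level k. g \<sigma> (Psi y \<sigma>)) \<partial>gauss_I) = (\<Prod>\<sigma>\<in>level k. \<integral>\<^sup>+a. g \<sigma> a \<partial>gauss)"
  using assms
proof (induction k arbitrary: g)
  case 0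
  then show ?case
    using nn_integral_gauss_I_prod[of "{None}" "\<lambda>_. g []"] by simp
next
  case (Suc k)
  note Suc.prems[measurable]
  define f where "f \<sigma> a b = g (\<sigma> @ [False]) ((a + b) / complex_of_real (sqrt 2)) *
      g (\<sigma> @ [True]) ((a - b) / complex_of_real (sqrt 2))" for \<sigma> a b
  have f1[measurable]: "(\<lambda>x. f \<sigma> (h x) (h' x)) \<in> borel_measurable M"
    if [measurable]: "h \<in> borel_measurable M" "h' \<in> borel_measurable M" for \<sigma> h h' and M :: "'z measure"
    unfolding f_def by measurable
  have f2[measurable]: "(\<lambda>a. \<integral>\<^sup>+b. f \<sigma> a b \<partial>gauss) \<in> borel_measurable borel" for \<sigma>
    by measurable
  let ?F = "\<lambda>y. \<Prod>\<sigma>\<in>level k. f \<sigma> (Psi y \<sigma>) (y (Some \<sigma>))"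
  have "(\<integral>\<^sup>+y. (\<Prod>\<sigma>\<in>level (Suc k). g \<sigma> (Psi y \<sigma>)) \<partial>gauss_I) = (\<integral>\<^sup>+y. ?F y \<partial>gauss_I)"
    by (simp add: prod_level_Suc Psi_snoc f_def)
  \<comment> \<open>Splicing separates old from new: \<open>Psi\<close> at length k reads only
    coordinates kept from y, while the coordinates \<open>Some \<sigma>\<close> at length k are
    resampled from z.\<close>
  also have "\<dots> = (\<integral>\<^sup>+y. \<integral>\<^sup>+z. ?F (\<lambda>i. if i \<in> coords_below k then y i else z i) \<partial>gauss_I \<partial>gauss_I)"
    by (rule nn_integral_merge[symmetric]) measurable
  also have "\<dots> = (\<integral>\<^sup>+y. \<integral>\<^sup>+z. (\<Prod>\<sigma>\<in>level k. f \<sigma> (Psi y \<sigma>) (z (Some \<sigma>))) \<partial>gauss_I \<partial>gauss_I)"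
  proof (intro nn_integral_cong prod.cong refl)
    fix y z :: "bool list option \<Rightarrow> complex" and \<sigma> assume "\<sigma> \<in> level k"
    then have "Psi (\<lambda>i. if i \<in> coords_below k then y i else z i) \<sigma> = Psi y \<sigma>"
      by (intro Psi_cong) simp
    with \<open>\<sigma> \<in> level k\<close> show "f \<sigma> (Psi (\<lambda>i. if i \<in> coords_below k then y i else z i) \<sigma>)
        (if Some \<sigma> \<in> coords_below k then y (Some \<sigma>) else z (Some \<sigma>)) = f \<sigma> (Psi y \<sigma>) (z (Some \<sigma>))"
      by simp
  qed
  also have "\<dots> = (\<integral>\<^sup>+y. (\<Prod>\<sigma>\<in>level k. \<integral>\<^sup>+b. f \<sigma> (Psi y \<sigma>) b \<partial>gauss) \<partial>gauss_I)"
    by (intro nn_integral_cong nn_integral_level_prod) measurable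
  also have "\<dots> = (\<Prod>\<sigma>\<in>level k. \<integral>\<^sup>+a. \<integral>\<^sup>+b. f \<sigma> a b \<partial>gauss \<partial>gauss)"
    by (rule Suc.IH) measurable
  also have "\<dots> = (\<Prod>\<sigma>\<in>level (Suc k). \<integral>\<^sup>+a. g \<sigma> a \<partial>gauss)"
    by (simp add: prod_level_Suc f_def nn_integral_gauss_split)
  finally show ?case .
qed

subsection \<open>The action in Haar coordinates\<close>

lemma X_omega_split: "x \<in> X_omega \<Longrightarrow> x \<sigma> = (x (\<sigma> @ [False]) + x (\<sigma> @ [True])) / complex_of_real (sqrt 2)"
  unfolding X_omega_def by blast

lemma descend_X_omega: "x \<in> X_omega \<Longrightarrow> descend d x \<sigma> = x \<sigma>"
  by (induction d arbitrary: \<sigma>) (simp_all flip: X_omega_split)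

lemma descend_cong:
  "(\<And>\<tau>. length \<tau> = length \<sigma> + d \<Longrightarrow> v \<tau> = w \<tau>) \<Longrightarrow> descend d v \<sigma> = descend d w \<sigma>"
  by (induction d arbitrary: \<sigma>) simp_all

lemma measurable_descend:
  "(\<And>\<tau>. length \<tau> = length \<sigma> + d \<Longrightarrow> (\<lambda>y. X y \<tau>) \<in> borel_measurable M)
    \<Longrightarrow> (\<lambda>y. descend d (X y) \<sigma>) \<in> borel_measurable M"
proof (induction d arbitrary: \<sigma>)
  case (Suc d)
  from Suc.IH[of "\<sigma> @ [b]" for b] Suc.prems show ?case by simp
qed simp

lemma mix_add: "mix s (a + b) (c + d) = mix s a c + mix s b d"
  and mix_diff: "mix s (a - b) (c - d) = mix s a c - mix s b d"
  and mix_divide: "mix s (a / r) (b / r) = mix s a b / r"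
  by (simp_all add: mix_def diff_divide_distrib add_divide_distrib algebra_simps)

lemma descend_mix: "descend d (\<lambda>\<sigma>. mix s (v \<sigma>) (w \<sigma>)) \<sigma> = mix s (descend d v \<sigma>) (descend d w \<sigma>)"
  by (induction d arbitrary: \<sigma>) (simp_all add: mix_add mix_divide)

text \<open>
  Recovers the coordinates of \<open>Phi x\<close> below level \<open>k\<close> from the values of \<open>x\<close> on sequences of length \<open>k\<close>
  alone.
\<close>

definition haar :: "nat \<Rightarrow> (bool list \<Rightarrow> complex) \<Rightarrow> bool list option \<Rightarrow> complex" where
  "haar k v i = (case i of
      None \<Rightarrow> descend k v []
    | Some \<sigma> \<Rightarrow> if length \<sigma> < k
        then (descend (k - Suc (length \<sigma>)) v (\<sigma> @ [False]) - descend (k - Suc (length \<sigma>)) v (\<sigma> @ [True]))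
          / complex_of_real (sqrt 2)
        else 0)"

lemma haar_X_omega: "x \<in> X_omega \<Longrightarrow> i \<in> coords_below k \<Longrightarrow> haar k x i = Phi x i"
  by (cases i) (simp_all add: haar_def Phi_def descend_X_omega)

lemma haar_Psi: "i \<in> coords_below k \<Longrightarrow> haar k (Psi y) i = y i"
  by (simp add: haar_X_omega Psi_in Phi_Psi)

lemma haar_cong: "(\<And>\<tau>. length \<tau> = k \<Longrightarrow> v \<tau> = w \<tau>) \<Longrightarrow> haar k v = haar k w"
  by (auto simp: haar_def fun_eq_iff split: option.split
      intro!: descend_cong arg_cong2[where f = minus])

lemma haar_mix: "haar k (\<lambda>\<sigma>. mix s (v \<sigma>) (w \<sigma>)) i = mix s (haar k v i) (haar k w i)"
  by (auto simp: haar_def descend_mix mix_diff mix_divide split: option.split) (simp add: mix_def)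

lemma measurable_haar:
  assumes X: "\<And>\<tau>. length \<tau> = k \<Longrightarrow> (\<lambda>y. X y \<tau>) \<in> borel_measurable M"
  shows "(\<lambda>y. haar k (X y)) \<in> M \<rightarrow>\<^sub>M gauss_I"
proof -
  have "(\<lambda>y. haar k (X y) i) \<in> borel_measurable M" for i
  proof (cases i)
    case None
    then show ?thesis using measurable_descend[of "[]" k X M] X by (simp add: haar_def)
  next
    case (Some \<sigma>)
    have [measurable]: "(\<lambda>y. descend (k - Suc (length \<sigma>)) (X y) (\<sigma> @ [b])) \<in> borel_measurable M"
      if "length \<sigma> < k" for b
      using that X by (intro measurable_descend) auto
    show ?thesis by (cases "length \<sigma> < k") (simp_all add: haar_def Some)
  qed
  then show ?thesis by (rule measurable_gauss_I_coordwise)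
qed

text \<open>Independence and standard Gaussian law of the family on \<open>level k\<close>, encoded
  by a product formula for arbitrary test functions so that rescaling the family and passing to
  indicators are mere substitutions for g.\<close>

definition iid_level :: "nat \<Rightarrow> ((bool list option \<Rightarrow> complex) \<Rightarrow> bool list \<Rightarrow> complex) \<Rightarrow> bool" where
  "iid_level k X \<longleftrightarrow> (\<forall>\<sigma>. (\<lambda>y. X y \<sigma>) \<in> borel_measurable gauss_I) \<and>
    (\<forall>g. (\<forall>\<sigma>. g \<sigma> \<in> borel_measurable borel) \<longrightarrow>
      (\<integral>\<^sup>+y. (\<Prod>\<sigma>\<in>level k. g \<sigma> (X y \<sigma>)) \<partial>gauss_I) = (\<Prod>\<sigma>\<in>level k. \<integral>\<^sup>+a. g \<sigma> a \<partial>gauss))"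

lemma iid_level_Psi: "iid_level k Psi"
  by (simp add: iid_level_def nn_integral_level_prod_Psi)

lemma iid_level_coord: "iid_level k (\<lambda>y \<sigma>. y (Some \<sigma>))"
  by (simp add: iid_level_def nn_integral_level_prod)

lemma iid_level_unit:
  assumes X: "iid_level k X" and u: "\<And>\<sigma>. norm (u \<sigma>) = 1"
  shows "iid_level k (\<lambda>y \<sigma>. u \<sigma> * X y \<sigma>)"
  unfolding iid_level_def
proof (intro conjI allI impI)
  have [measurable]: "(\<lambda>y. X y \<sigma>) \<in> borel_measurable gauss_I" for \<sigma>
    using X by (simp add: iid_level_def)
  show "(\<lambda>y. u \<sigma> * X y \<sigma>) \<in> borel_measurable gauss_I" for \<sigma>
    by measurable
  fix g :: "bool list \<Rightarrow> complex \<Rightarrow> ennreal" assume "\<forall>\<sigma>. g \<sigma> \<in> borel_measurable borel"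
  then have g[measurable]: "g \<sigma> \<in> borel_measurable borel" for \<sigma> by simp
  have m: "(\<lambda>a. g \<sigma> (u \<sigma> * a)) \<in> borel_measurable borel" for \<sigma>
    by measurable
  have "(\<integral>\<^sup>+y. (\<Prod>\<sigma>\<in>level k. g \<sigma> (u \<sigma> * X y \<sigma>)) \<partial>gauss_I)
    = (\<Prod>\<sigma>\<in>level k. \<integral>\<^sup>+a. g \<sigma> (u \<sigma> * a) \<partial>gauss)"
    using X m unfolding iid_level_def by (auto dest!: spec[of _ "\<lambda>\<sigma> a. g \<sigma> (u \<sigma> * a)"])
  also have "\<dots> = (\<Prod>\<sigma>\<in>level k. \<integral>\<^sup>+a. g \<sigma> a \<partial>gauss)"
    by (intro prod.cong nn_integral_gauss_unit g u refl)
  finally show "(\<integral>\<^sup>+y. (\<Prod>\<sigma>\<in>level k. g \<sigma> (u \<sigma> * X y \<sigma>)) \<partial>gauss_I)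
    = (\<Prod>\<sigma>\<in>level k. \<integral>\<^sup>+a. g \<sigma> a \<partial>gauss)" .
qed

text \<open>\<open>haar k\<close> reads only \<open>level k\<close>, where the joint law is the
  product measure. The right-hand side does not mention X, so all such families can be compared with
  each other.\<close>

lemma distr_haar_iid:
  assumes "iid_level k X"
  shows "distr gauss_I gauss_I (\<lambda>y. haar k (X y)) = distr (PiM (level k) (\<lambda>_. gauss)) gauss_I (haar k)"
proof -
  interpret pp: product_prob_space "\<lambda>_ :: bool list. gauss" UNIV
    by (rule product_prob_spaceI) (rule prob_space_gauss)
  let ?P = "PiM (level k) (\<lambda>_. gauss)" and ?r = "\<lambda>y. restrict (X y) (level k)"
  have [measurable]: "(\<lambda>y. X y \<sigma>) \<in> borel_measurable gauss_I" for \<sigma>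
    using assms by (simp add: iid_level_def)
  have r[measurable]: "?r \<in> gauss_I \<rightarrow>\<^sub>M ?P"
    by (rule measurable_restrict) (simp add: measurable_cong_sets[OF refl sets_gauss])
  have "distr gauss_I ?P ?r = ?P"
  proof (rule pp.PiM_eqI)
    fix A assume A0: "\<And>\<sigma>. \<sigma> \<in> level k \<Longrightarrow> A \<sigma> \<in> sets gauss"
    define A' where "A' \<sigma> = (if \<sigma> \<in> level k then A \<sigma> else {})" for \<sigma>
    have A[measurable]: "A' \<sigma> \<in> sets borel" for \<sigma>
      using A0 by (auto simp: A'_def)
    have E: "Pi\<^sub>E (level k) A \<in> sets ?P"
      using A0 by (intro sets_PiM_I_finite) auto
    have S: "?r -` Pi\<^sub>E (level k) A \<inter> space gauss_I = {y. \<forall>\<sigma>\<in>level k. X y \<sigma> \<in> A' \<sigma>}"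
      by (auto simp: A'_def PiE_iff)
    have ind: "indicator {y. \<forall>\<sigma>\<in>level k. X y \<sigma> \<in> A' \<sigma>} y = (\<Prod>\<sigma>\<in>level k. indicator (A' \<sigma>) (X y \<sigma>) :: ennreal)" for y
    proof -
      have "finite J \<Longrightarrow> indicator {y. \<forall>\<sigma>\<in>J. X y \<sigma> \<in> A' \<sigma>} y = (\<Prod>\<sigma>\<in>J. indicator (A' \<sigma>) (X y \<sigma>) :: ennreal)" for J
        by (induction J rule: finite_induct) (auto simp: indicator_def)
      from this[OF finite_level] show ?thesis .
    qed
    have S': "{y. \<forall>\<sigma>\<in>level k. X y \<sigma> \<in> A' \<sigma>} \<in> sets gauss_I"
      using measurable_sets[OF r E] by (simp only: S)
    have "emeasure (distr gauss_I ?P ?r) (Pi\<^sub>E (level k) A)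
      = emeasure gauss_I {y. \<forall>\<sigma>\<in>level k. X y \<sigma> \<in> A' \<sigma>}"
      by (simp only: emeasure_distr[OF r E] S)
    also have "\<dots> = (\<integral>\<^sup>+y. (\<Prod>\<sigma>\<in>level k. indicator (A' \<sigma>) (X y \<sigma>)) \<partial>gauss_I)"
      by (simp only: nn_integral_indicator[OF S', symmetric] ind)
    also have "\<dots> = (\<Prod>\<sigma>\<in>level k. emeasure gauss (A' \<sigma>))"
      using assms unfolding iid_level_def by (auto dest!: spec[of _ "\<lambda>\<sigma>. indicator (A' \<sigma>)"])
    also have "\<dots> = (\<Prod>\<sigma>\<in>level k. emeasure gauss (A \<sigma>))"
      by (simp add: A'_def)
    finally show "emeasure (distr gauss_I ?P ?r) (Pi\<^sub>E (level k) A) = (\<Prod>\<sigma>\<in>level k. emeasure gauss (A \<sigma>))" .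
  qed simp_all
  then have "distr ?P gauss_I (haar k) = distr (distr gauss_I ?P ?r) gauss_I (haar k)" by simp
  also have "\<dots> = distr gauss_I gauss_I (haar k \<circ> ?r)"
  proof (rule distr_distr[OF _ r], rule measurable_haar)
    fix \<tau> :: "bool list" assume "length \<tau> = k"
    then have "(\<lambda>v. v \<tau>) \<in> ?P \<rightarrow>\<^sub>M gauss" by (intro measurable_component_singleton) simp
    then show "(\<lambda>v. v \<tau>) \<in> borel_measurable ?P"
      by (simp add: measurable_cong_sets[OF refl sets_gauss])
  qed
  \<comment> \<open>The restriction puts \<open>undefined\<close> off \<open>level k\<close>, where
    \<open>haar k\<close> never looks.\<close>
  also have "haar k \<circ> ?r = (\<lambda>y. haar k (X y))"
  proof
    fix y show "(haar k \<circ> ?r) y = haar k (X y)"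
      unfolding comp_def by (rule haar_cong) simp
  qed
  finally show ?thesis ..
qed

section \<open>Events decided by finitely many coordinates\<close>

definition cylinder :: "nat \<Rightarrow> (bool list option \<Rightarrow> complex) set \<Rightarrow> bool" where
  "cylinder k C \<longleftrightarrow> C \<in> sets gauss_I \<and>
    (\<forall>y y'. (\<forall>i\<in>coords_below k. y i = y' i) \<longrightarrow> (y \<in> C \<longleftrightarrow> y' \<in> C))"

lemma cylinder_sets [measurable_dest]: "cylinder k C \<Longrightarrow> C \<in> sets gauss_I"
  by (simp add: cylinder_def)

lemma cylinderD: "cylinder k C \<Longrightarrow> (\<And>i. i \<in> coords_below k \<Longrightarrow> y i = y' i) \<Longrightarrow> y \<in> C \<longleftrightarrow> y' \<in> C"
  by (auto simp: cylinder_def)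

lemma cylinder_mono: "cylinder j C \<Longrightarrow> j \<le> k \<Longrightarrow> cylinder k C"
  using coords_below_mono[of j k] unfolding cylinder_def by blast

text \<open>The probability is the same for every such family, and for \<open>Psi\<close> the event
  is C itself, because \<open>haar k (Psi y)\<close> agrees with y on the coordinates that decide
  C.\<close>

lemma emeasure_haar_cylinder:
  assumes X: "iid_level k X" and C: "cylinder k C"
  shows "emeasure gauss_I {y. haar k (X y) \<in> C} = emeasure gauss_I C"
proof -
  have *: "emeasure gauss_I {y. haar k (Z y) \<in> C}
    = emeasure (distr (PiM (level k) (\<lambda>_. gauss)) gauss_I (haar k)) C" if "iid_level k Z" for Z
  proof -
    have "(\<lambda>y. haar k (Z y)) \<in> gauss_I \<rightarrow>\<^sub>M gauss_I"
      by (rule measurable_haar) (use that in \<open>simp add: iid_level_def\<close>)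
    then show ?thesis
      using cylinder_sets[OF C] by (simp add: emeasure_distr vimage_def flip: distr_haar_iid[OF that])
  qed
  have "{y. haar k (Psi y) \<in> C} = C"
    using cylinderD[OF C, of "haar k (Psi y)" y for y] by (auto simp: haar_Psi)
  then show ?thesis using *[OF X] *[OF iid_level_Psi] by simp
qed

section \<open>The action of \<open>gs s k\<close> on coordinate sequences\<close>

definition unit :: "real \<Rightarrow> bool \<Rightarrow> complex" where
  "unit s b = (1 + \<i> * complex_of_real s * (-1) ^ of_bool b) / complex_of_real (sqrt (1 + s\<^sup>2))"

lemma gs_unit: "gs s k x = unit s (x k)"
  by (simp add: gs_def unit_def)

lemma norm_unit [simp]: "norm (unit s b) = 1"
proof -
  have "gs s 0 (\<lambda>_. b) \<in> sphere 0 1"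
    using gs_in_S_level[of s 0] unfolding S_level_def by blast
  then show ?thesis by (simp add: gs_unit)
qed

lemma cyl_val_gs: "k < length \<sigma> \<Longrightarrow> cyl_val (gs s k) \<sigma> = unit s (\<sigma> ! k)"
  using extends_ex[of \<sigma>] cyl_val_eq[OF gs_in_S_level, of k \<sigma>] by (auto simp: extends_def gs_unit)

definition twist :: "real \<Rightarrow> nat \<Rightarrow> (bool list option \<Rightarrow> complex) \<Rightarrow> bool list option \<Rightarrow> complex" where
  "twist s k y = Phi (act (gs s k) (Psi y))"

lemma Psi_twist: "Psi (twist s k y) = act (gs s k) (Psi y)"
  by (simp add: twist_def Psi_Phi act_spec(1)[OF gs_in_S_level Psi_in])

lemma Psi_twist_above: "k < length \<sigma> \<Longrightarrow> Psi (twist s k y) \<sigma> = unit s (\<sigma> ! k) * Psi y \<sigma>"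
  by (simp add: Psi_twist act_spec(2)[OF gs_in_S_level Psi_in] cyl_val_gs)

text \<open>From length k + 1 on the action is pointwise multiplication, so reading at a length n >
  k gives a formula in finitely many values of \<open>Psi y\<close>. Measurability and invariance of
  the measure come from it.\<close>

lemma twist_eq_haar:
  "k < n \<Longrightarrow> i \<in> coords_below n \<Longrightarrow> twist s k y i = haar n (\<lambda>\<sigma>. unit s (\<sigma> ! k) * Psi y \<sigma>) i"
  using haar_cong[of n "Psi (twist s k y)" "\<lambda>\<sigma>. unit s (\<sigma> ! k) * Psi y \<sigma>"]
    haar_Psi[of i n "twist s k y"]
  by (simp add: Psi_twist_above)

lemma measurable_twist [measurable]: "twist s k \<in> gauss_I \<rightarrow>\<^sub>M gauss_I"
proof -
  have "(\<lambda>y. twist s k y i) \<in> borel_measurable gauss_I" for i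
  proof -
    \<comment> \<open>Large enough both to exceed k and to have i below it.\<close>
    define n where "n = Suc k + (case i of None \<Rightarrow> 0 | Some \<sigma> \<Rightarrow> Suc (length \<sigma>))"
    have i: "i \<in> coords_below n" "k < n" by (auto simp: n_def split: option.split)
    have [measurable]: "(\<lambda>y. haar n (\<lambda>\<sigma>. unit s (\<sigma> ! k) * Psi y \<sigma>)) \<in> gauss_I \<rightarrow>\<^sub>M gauss_I"
      by (rule measurable_haar) measurable
    have "(\<lambda>y. haar n (\<lambda>\<sigma>. unit s (\<sigma> ! k) * Psi y \<sigma>) i) \<in> borel_measurable gauss_I"
      by measurable
    then show ?thesis by (simp add: twist_eq_haar[OF i(2,1)])
  qed
  then show ?thesis by (rule measurable_gauss_I_coordwise)
qed

text \<open>The sign - s belongs to the inverse group element. The two children are multiplied by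
  conjugate unit numbers; in their sum the real parts keep \<open>Psi y \<sigma>\<close> and the
  imaginary parts bring in the Haar coefficient.\<close>

lemma Psi_twist_level:
  assumes "length \<sigma> = k"
  shows "Psi (twist (- s) k y) \<sigma> = mix s (Psi y \<sigma>) (y (Some \<sigma>))"
proof -
  have above: "Psi (twist (- s) k y) (\<sigma> @ [b]) = unit (- s) b * Psi y (\<sigma> @ [b])" for b
    using assms by (simp add: Psi_twist_above nth_append)
  have "Psi (twist (- s) k y) \<sigma> = (Psi (twist (- s) k y) (\<sigma> @ [False]) + Psi (twist (- s) k y) (\<sigma> @ [True]))
      / complex_of_real (sqrt 2)"
    by (rule X_omega_split) (rule Psi_in)
  \<comment> \<open>One factor sqrt 2 comes from the values at the children, the other from
    averaging them.\<close>
  also have "\<dots> = (unit (- s) False * (Psi y \<sigma> + y (Some \<sigma>)) + unit (- s) True * (Psi y \<sigma> - y (Some \<sigma>)))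
      / (complex_of_real (sqrt 2) * complex_of_real (sqrt 2))"
    unfolding above by (simp add: Psi_snoc flip: add_divide_distrib)
  also have "\<dots> = mix s (Psi y \<sigma>) (y (Some \<sigma>))"
  proof -
    let ?c = "complex_of_real (sqrt (1 + s\<^sup>2))" and ?t = "\<i> * complex_of_real s"
    have u: "unit (- s) False = (1 - ?t) / ?c" "unit (- s) True = (1 + ?t) / ?c"
      by (simp_all add: unit_def)
    have "(1 - ?t) * (Psi y \<sigma> + y (Some \<sigma>)) + (1 + ?t) * (Psi y \<sigma> - y (Some \<sigma>))
      = 2 * (Psi y \<sigma> - ?t * y (Some \<sigma>))"
      by (simp add: algebra_simps)
    then show ?thesis
      unfolding sqrt2_sq u mix_def times_divide_eq_left add_divide_distrib[symmetric]
      by (simp del: right_diff_distrib_numeral)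
  qed
  finally show ?thesis .
qed

text \<open>Linearity of \<open>haar k\<close> carries the formula at length k down to shorter
  sequences. The second argument uses only coordinates \<open>Some \<sigma>\<close> with \<sigma> of
  length k, none of which is in \<open>coords_below k\<close>; this is the source of
  independence.\<close>

lemma twist_below:
  assumes "i \<in> coords_below k"
  shows "twist (- s) k y i = mix s (y i) (haar k (\<lambda>\<sigma>. y (Some \<sigma>)) i)"
proof -
  have "twist (- s) k y i = haar k (Psi (twist (- s) k y)) i"
    by (simp add: haar_Psi assms)
  also have "haar k (Psi (twist (- s) k y)) = haar k (\<lambda>\<sigma>. mix s (Psi y \<sigma>) (y (Some \<sigma>)))"
    by (rule haar_cong) (simp add: Psi_twist_level)
  finally show ?thesis by (simp add: haar_mix haar_Psi assms)
qed

subsection \<open>Cylinder sets and the limit law\<close>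

lemma cylinder_Int: "cylinder k A \<Longrightarrow> cylinder k B \<Longrightarrow> cylinder k (A \<inter> B)"
  unfolding cylinder_def by blast

lemma cylinder_Un: "cylinder k A \<Longrightarrow> cylinder k B \<Longrightarrow> cylinder k (A \<union> B)"
  unfolding cylinder_def by blast

lemma cylinder_Compl: "cylinder k A \<Longrightarrow> cylinder k (- A)"
  using sets.compl_sets[of A gauss_I] unfolding cylinder_def by (auto simp: Compl_eq_Diff_UNIV)

lemma cylinder_common:
  assumes "cylinder j A" "cylinder k B"
  shows "cylinder (max j k) A" "cylinder (max j k) B"
  using assms cylinder_mono by simp_all

lemma Int_stable_cylinder: "Int_stable {C. \<exists>k. cylinder k C}"
  by (auto intro!: Int_stableI intro: cylinder_Int cylinder_common)

lemma sets_gauss_I_cylinder: "sets gauss_I = sigma_sets UNIV {C. \<exists>k. cylinder k C}"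
proof
  show "sets gauss_I \<subseteq> sigma_sets UNIV {C. \<exists>k. cylinder k C}"
    unfolding sets_gauss_I sets_PiM_single space_borel PiE_UNIV_domain Pi_UNIV
  proof (rule sigma_sets_mono, safe)
    fix i :: "bool list option" and A :: "complex set" assume [measurable]: "A \<in> sets borel"
    define k where "k = (case i of None \<Rightarrow> 0 | Some \<sigma> \<Rightarrow> Suc (length \<sigma>))"
    have "i \<in> coords_below k" by (simp add: k_def split: option.split)
    moreover have "{f. f i \<in> A} \<in> sets gauss_I"
      using measurable_sets[OF measurable_coord[of i] \<open>A \<in> sets borel\<close>] by (simp add: vimage_def)
    ultimately have "cylinder k {f. f i \<in> A}" by (simp add: cylinder_def)
    then show "{f \<in> UNIV. f i \<in> A} \<in> sigma_sets UNIV {C. \<exists>k. cylinder k C}"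
      by (auto intro!: sigma_sets.Basic)
  qed
  show "sigma_sets UNIV {C. \<exists>k. cylinder k C} \<subseteq> sets gauss_I"
    using sets.sigma_sets_subset[of "{C. \<exists>k. cylinder k C}" gauss_I] by (auto simp: cylinder_def)
qed

text \<open>At a length beyond k the action multiplies independent Gaussians by unit numbers, which
  keeps their joint law, and every cylinder set is decided at such a length.\<close>

lemma distr_twist: "distr gauss_I gauss_I (twist s k) = gauss_I"
proof (rule measure_eqI_generator_eq[OF Int_stable_cylinder, where A = "\<lambda>_. UNIV" and \<Omega> = UNIV])
  fix C assume "C \<in> {C. \<exists>k. cylinder k C}"
  then obtain j where "cylinder j C" by auto
  then have C: "cylinder (Suc (max j k)) C" by (rule cylinder_mono) simp
  let ?n = "Suc (max j k)" and ?X = "\<lambda>y \<sigma>. unit s (\<sigma> ! k) * Psi y \<sigma>"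
  have "emeasure (distr gauss_I gauss_I (twist s k)) C = emeasure gauss_I {y. twist s k y \<in> C}"
    using cylinder_sets[OF C] by (simp add: emeasure_distr vimage_def)
  also have "{y. twist s k y \<in> C} = {y. haar ?n (?X y) \<in> C}"
    using cylinderD[OF C, of "twist s k y" "haar ?n (?X y)" for y] by (auto simp: twist_eq_haar)
  also have "emeasure gauss_I \<dots> = emeasure gauss_I C"
    by (intro emeasure_haar_cylinder C iid_level_unit iid_level_Psi) simp
  finally show "emeasure (distr gauss_I gauss_I (twist s k)) C = emeasure gauss_I C" .
next
  have "cylinder 0 UNIV" using sets.top[of gauss_I] by (simp add: cylinder_def)
  then show "range (\<lambda>_. UNIV) \<subseteq> {C. \<exists>k. cylinder k C}" by auto
  have "UNIV \<in> sets gauss_I" using sets.top[of gauss_I] by simp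
  then show "emeasure (distr gauss_I gauss_I (twist s k)) UNIV \<noteq> \<infinity>"
    by (simp add: emeasure_distr)
qed (simp_all add: sets_gauss_I_cylinder)

lemma measure_twist_vimage:
  assumes "A \<in> sets gauss_I"
  shows "measure gauss_I {y. twist s k y \<in> A} = measure gauss_I A"
proof -
  have "measure gauss_I A = measure (distr gauss_I gauss_I (twist s k)) A"
    by (simp add: distr_twist)
  also have "\<dots> = measure gauss_I {y. twist s k y \<in> A}"
    using assms by (simp add: measure_distr vimage_def)
  finally show ?thesis ..
qed

text \<open>When both sets are decided below the index k of the twist, the limit law is attained
  exactly: the twist mixes y with the transform of its coordinates at length k, which is independent
  of the coordinates below k and has there the law of a fresh copy.\<close>

lemma emeasure_twist_cylinder:
  assumes B: "cylinder k B" and C: "cylinder k C"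
  shows "emeasure gauss_I {y \<in> B. twist (- s) k y \<in> C}
    = (\<integral>\<^sup>+y. \<integral>\<^sup>+z. indicator B y * indicator C (mixes s y z) \<partial>gauss_I \<partial>gauss_I)"
proof -
  note [measurable] = cylinder_sets[OF B] cylinder_sets[OF C]
  let ?W = "\<lambda>y. haar k (\<lambda>\<sigma>. y (Some \<sigma>))"
  let ?m = "\<lambda>y z i. if i \<in> coords_below k then y i else z i"
  \<comment> \<open>After splicing, B and the first argument of the mixture see only y, and the
    transform \<open>?W\<close> sees only z.\<close>
  have mem: "?m y z \<in> B \<longleftrightarrow> y \<in> B" "twist (- s) k (?m y z) \<in> C \<longleftrightarrow> mixes s y (?W z) \<in> C" for y z
  proof -
    have "?W (?m y z) = ?W z" by (rule haar_cong) simp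
    then show "?m y z \<in> B \<longleftrightarrow> y \<in> B" "twist (- s) k (?m y z) \<in> C \<longleftrightarrow> mixes s y (?W z) \<in> C"
      by (auto intro!: cylinderD[OF B] cylinderD[OF C] simp: twist_below)
  qed
  have S[measurable]: "{y \<in> B. twist (- s) k y \<in> C} \<in> sets gauss_I"
  proof -
    have "{y \<in> space gauss_I. y \<in> B \<and> twist (- s) k y \<in> C} \<in> sets gauss_I" by measurable
    then show ?thesis by (simp add: Collect_conj_eq)
  qed
  have "emeasure gauss_I {y \<in> B. twist (- s) k y \<in> C}
    = (\<integral>\<^sup>+y. indicator {y \<in> B. twist (- s) k y \<in> C} y \<partial>gauss_I)"
    by simp
  also have "\<dots> = (\<integral>\<^sup>+y. \<integral>\<^sup>+z. indicator {y \<in> B. twist (- s) k y \<in> C} (?m y z) \<partial>gauss_I \<partial>gauss_I)"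
    by (rule nn_integral_merge[symmetric]) measurable
  also have "\<dots> = (\<integral>\<^sup>+y. indicator B y * (\<integral>\<^sup>+z. indicator C (mixes s y (?W z)) \<partial>gauss_I) \<partial>gauss_I)"
    using mem by (intro nn_integral_cong) (auto simp: indicator_def)
  also have "\<dots> = (\<integral>\<^sup>+y. indicator B y * (\<integral>\<^sup>+z. indicator C (mixes s y z) \<partial>gauss_I) \<partial>gauss_I)"
  proof (rule nn_integral_cong, rule arg_cong2[where f = "(*)"], rule refl)
    fix y :: "bool list option \<Rightarrow> complex"
    have [measurable]: "mixes s y \<in> gauss_I \<rightarrow>\<^sub>M gauss_I" by measurable
    \<comment> \<open>With y fixed the slice is again a cylinder set, so \<open>?W z\<close> may be
      replaced by z itself without changing its probability.\<close>
    have D: "cylinder k {z. mixes s y z \<in> C}"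
      unfolding cylinder_def
    proof (intro conjI allI impI)
      show "{z. mixes s y z \<in> C} \<in> sets gauss_I"
        using measurable_sets[of "mixes s y" gauss_I gauss_I C] by (simp add: vimage_def)
    qed (auto intro!: cylinderD[OF C])
    have W: "?W \<in> gauss_I \<rightarrow>\<^sub>M gauss_I" by (rule measurable_haar) measurable
    have D': "{z. mixes s y (?W z) \<in> C} \<in> sets gauss_I"
      using measurable_sets[OF W cylinder_sets[OF D]] by (simp add: vimage_def)
    have "(\<integral>\<^sup>+z. indicator C (mixes s y (?W z)) \<partial>gauss_I) = (\<integral>\<^sup>+z. indicator {z. mixes s y (?W z) \<in> C} z \<partial>gauss_I)"
      by (intro nn_integral_cong) (simp add: indicator_def)
    also have "\<dots> = emeasure gauss_I {z. ?W z \<in> {z. mixes s y z \<in> C}}"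
      unfolding mem_Collect_eq by (rule nn_integral_indicator[OF D'])
    also have "\<dots> = emeasure gauss_I {z. mixes s y z \<in> C}"
      by (rule emeasure_haar_cylinder[OF iid_level_coord D])
    also have "\<dots> = (\<integral>\<^sup>+z. indicator {z. mixes s y z \<in> C} z \<partial>gauss_I)"
      by (rule nn_integral_indicator[OF cylinder_sets[OF D], symmetric])
    also have "\<dots> = (\<integral>\<^sup>+z. indicator C (mixes s y z) \<partial>gauss_I)"
      by (intro nn_integral_cong) (simp add: indicator_def)
    finally show "(\<integral>\<^sup>+z. indicator C (mixes s y (?W z)) \<partial>gauss_I) = (\<integral>\<^sup>+z. indicator C (mixes s y z) \<partial>gauss_I)" .
  qed
  also have "\<dots> = (\<integral>\<^sup>+y. \<integral>\<^sup>+z. indicator B y * indicator C (mixes s y z) \<partial>gauss_I \<partial>gauss_I)"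
    by (intro nn_integral_cong) (auto simp: indicator_def)
  finally show ?thesis .
qed

text \<open>Cylinder sets form an intersection-stable generator, so it suffices that approximable
  sets are closed under complements and disjoint countable unions. For the latter, a finite partial
  union is close to the whole by continuity from below.\<close>

lemma cylinder_approx:
  assumes "A \<in> sets gauss_I" "0 < e"
  shows "\<exists>k C. cylinder k C \<and> measure gauss_I (sym_diff A C) < e"
proof -
  define ap where "ap A \<longleftrightarrow> (\<forall>e>0. \<exists>k C. cylinder k C \<and> measure gauss_I (sym_diff A C) < e)" for A
  have sub: "measure gauss_I (sym_diff A C) \<le> measure gauss_I (sym_diff A1 C1) + measure gauss_I (sym_diff A2 C2)"
    if "sym_diff A C \<subseteq> sym_diff A1 C1 \<union> sym_diff A2 C2"
      and "A1 \<in> sets gauss_I" "C1 \<in> sets gauss_I" "A2 \<in> sets gauss_I" "C2 \<in> sets gauss_I"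
    for A C A1 C1 A2 C2
    using that by (intro order_trans[OF gauss_I.finite_measure_mono measure_Un_le]) auto
  have ap_Un: "ap (A \<union> B)" if A: "ap A" "A \<in> sets gauss_I" and B: "ap B" "B \<in> sets gauss_I" for A B
    unfolding ap_def
  proof (intro allI impI)
    fix e :: real assume "0 < e"
    then have "0 < e / 2" by simp
    then obtain j C k D where C: "cylinder j C" "measure gauss_I (sym_diff A C) < e / 2"
      and D: "cylinder k D" "measure gauss_I (sym_diff B D) < e / 2"
      using A B unfolding ap_def by meson
    have "measure gauss_I (sym_diff (A \<union> B) (C \<union> D))
        \<le> measure gauss_I (sym_diff A C) + measure gauss_I (sym_diff B D)"
      by (rule sub) (use A B C D cylinder_sets in auto)
    then show "\<exists>k E. cylinder k E \<and> measure gauss_I (sym_diff (A \<union> B) E) < e"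
      using C D cylinder_Un[OF cylinder_common[OF C(1) D(1)]] by fastforce
  qed
  have "{C. \<exists>k. cylinder k C} \<subseteq> Pow UNIV" by simp
  with Int_stable_cylinder have "ap A" using assms(1)[unfolded sets_gauss_I_cylinder]
  proof (induction rule: sigma_sets_induct_disjoint)
    case (basic C)
    then obtain k where "cylinder k C" by auto
    then show ?case unfolding ap_def by (auto intro!: exI[of _ k] exI[of _ C])
  next
    case empty
    have "cylinder 0 {}" by (simp add: cylinder_def)
    then show ?case unfolding ap_def by (auto intro!: exI[of _ 0] exI[of _ "{}"])
  next
    case (compl A)
    show ?case
      unfolding ap_def
    proof (intro allI impI)
      fix e :: real assume "0 < e"
      then obtain k C where "cylinder k C" "measure gauss_I (sym_diff A C) < e"
        using compl unfolding ap_def by blast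
      moreover have "sym_diff (UNIV - A) (- C) = sym_diff A C" by auto
      ultimately show "\<exists>k C. cylinder k C \<and> measure gauss_I (sym_diff (UNIV - A) C) < e"
        using cylinder_Compl by metis
    qed
  next
    case (union A)
    let ?U = "\<lambda>n. \<Union>i<n. A i"
    have A: "A i \<in> sets gauss_I" for i
      using union by (auto simp: sets_gauss_I_cylinder)
    then have U: "?U n \<in> sets gauss_I" for n by auto
    have fin: "ap (?U n)" for n
    proof (induction n)
      case 0
      have "cylinder 0 {}" by (simp add: cylinder_def)
      then show ?case unfolding ap_def by (auto intro!: exI[of _ 0] exI[of _ "{}"])
    next
      case (Suc n)
      have "?U (Suc n) = ?U n \<union> A n" by (auto simp: lessThan_Suc)
      with ap_Un[OF Suc U union(3) A] show ?case by simp
    qed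
    show ?case
      unfolding ap_def
    proof (intro allI impI)
      fix e :: real assume "0 < e"
      have "(\<lambda>n. measure gauss_I (?U n)) \<longlonglongrightarrow> measure gauss_I (\<Union>n. ?U n)"
        by (rule gauss_I.finite_Lim_measure_incseq) (use U in \<open>auto intro!: incseq_SucI simp: lessThan_Suc\<close>)
      moreover have "(\<Union>n. ?U n) = (\<Union>i. A i)" by auto
      ultimately have "(\<lambda>n. measure gauss_I (?U n)) \<longlonglongrightarrow> measure gauss_I (\<Union>i. A i)" by simp
      from LIMSEQ_D[OF this, of "e / 2"] \<open>0 < e\<close>
      obtain n where n: "norm (measure gauss_I (?U n) - measure gauss_I (\<Union>i. A i)) < e / 2" by auto
      have d: "sym_diff (\<Union>i. A i) (?U n) = (\<Union>i. A i) - ?U n" by auto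
      have "measure gauss_I (sym_diff (\<Union>i. A i) (?U n)) = measure gauss_I (\<Union>i. A i) - measure gauss_I (?U n)"
        unfolding d by (rule gauss_I.finite_measure_Diff) (use A U in auto)
      with n have n': "measure gauss_I (sym_diff (\<Union>i. A i) (?U n)) < e / 2"
        unfolding real_norm_def by linarith
      have "0 < e / 2" using \<open>0 < e\<close> by simp
      with fin[of n] obtain k C where C: "cylinder k C" "measure gauss_I (sym_diff (?U n) C) < e / 2"
        unfolding ap_def by blast
      have "measure gauss_I (sym_diff (\<Union>i. A i) C)
          \<le> measure gauss_I (sym_diff (\<Union>i. A i) (?U n)) + measure gauss_I (sym_diff (?U n) C)"
        by (rule sub) (use A U C cylinder_sets in auto)
      with n' C show "\<exists>k C. cylinder k C \<and> measure gauss_I (sym_diff (\<Union>i. A i) C) < e"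
        by fastforce
    qed
  qed
  with assms(2) show ?thesis unfolding ap_def by blast
qed

subsection \<open>Positivity and the main theorem\<close>

text \<open>
  Given all other coordinates, the law of the \<open>j\<close>-th one is equivalent to Lebesgue measure for every
  value of \<open>y j\<close>, so the right-hand side does not involve \<open>y j\<close>.
\<close>

lemma null_mixes_iff:
  assumes [measurable]: "K \<in> sets gauss_I" and "s \<noteq> 0"
  shows "(\<integral>\<^sup>+z. indicator K (mixes s y z) \<partial>gauss_I) = 0 \<longleftrightarrow>
    (AE z in gauss_I. (\<integral>\<^sup>+t. indicator K ((mixes s y z)(j := t)) \<partial>lborel) = 0)"
proof -
  have m1: "(\<lambda>p. (mixes s y (fst p))(j := mix s (y j) (snd p))) \<in> gauss_I \<Otimes>\<^sub>M gauss \<rightarrow>\<^sub>M gauss_I"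
    by (rule measurable_gauss_I_coordwise) (simp split del: if_split add: fun_upd_def, measurable)
  have m2: "(\<lambda>b. (mixes s y x)(j := b)) \<in> borel \<rightarrow>\<^sub>M gauss_I" for x
    by (rule measurable_gauss_I_coordwise) (simp split del: if_split add: fun_upd_def, measurable)
  have m3: "(\<lambda>b. indicator K ((mixes s y x)(j := b)) :: ennreal) \<in> borel_measurable borel" for x
    by (rule measurable_compose[OF m2]) measurable
  have m4: "(\<lambda>b. indicator K ((mixes s y x)(j := mix s (y j) b)) :: ennreal) \<in> borel_measurable borel" for x
    by (rule measurable_compose[OF _ m3]) measurable
  have "(\<lambda>p. indicator K ((mixes s y (fst p))(j := mix s (y j) (snd p))) :: ennreal)
      \<in> borel_measurable (gauss_I \<Otimes>\<^sub>M gauss)"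
    by (rule measurable_compose[OF m1]) measurable
  then have m5[measurable]: "(\<lambda>x. \<integral>\<^sup>+b. indicator K ((mixes s y x)(j := mix s (y j) b)) \<partial>gauss) \<in> borel_measurable gauss_I"
    by (intro gauss.borel_measurable_nn_integral) (simp add: case_prod_beta')
  \<comment> \<open>All coordinates but j are kept from x, and j alone is resampled.\<close>
  have "(\<integral>\<^sup>+z. indicator K (mixes s y z) \<partial>gauss_I)
    = (\<integral>\<^sup>+x. \<integral>\<^sup>+z. indicator K (mixes s y (\<lambda>i. if i \<in> - {j} then x i else z i)) \<partial>gauss_I \<partial>gauss_I)"
    by (rule nn_integral_merge[symmetric]) measurable
  also have "\<dots> = (\<integral>\<^sup>+x. \<integral>\<^sup>+z. indicator K ((mixes s y x)(j := mix s (y j) (z j))) \<partial>gauss_I \<partial>gauss_I)"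
    by (intro nn_integral_cong arg_cong[where f = "indicator K"]) auto
  also have "\<dots> = (\<integral>\<^sup>+x. \<integral>\<^sup>+b. indicator K ((mixes s y x)(j := mix s (y j) b)) \<partial>gauss \<partial>gauss_I)"
    using nn_integral_gauss_I_prod[of "{j}" "\<lambda>_ b. indicator K ((mixes s y x)(j := mix s (y j) b))" for x] m4
    by simp
  finally have "(\<integral>\<^sup>+z. indicator K (mixes s y z) \<partial>gauss_I) = 0 \<longleftrightarrow>
    (AE x in gauss_I. (\<integral>\<^sup>+b. indicator K ((mixes s y x)(j := mix s (y j) b)) \<partial>gauss) = 0)"
    by (simp only: nn_integral_0_iff_AE[OF m5])
  also have "(\<lambda>x. (\<integral>\<^sup>+b. indicator K ((mixes s y x)(j := mix s (y j) b)) \<partial>gauss) = 0)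
    = (\<lambda>x. (\<integral>\<^sup>+t. indicator K ((mixes s y x)(j := t)) \<partial>lborel) = 0)"
    by (intro ext nn_integral_gauss_mix_eq_0 m3 \<open>s \<noteq> 0\<close>)
  finally show ?thesis .
qed

text \<open>The criterion above overwrites the j-th coordinate of the mixture, which erases any
  change made to \<open>y j\<close>.\<close>

lemma null_mixes_upd:
  assumes "K \<in> sets gauss_I" "s \<noteq> 0"
  shows "(\<integral>\<^sup>+z. indicator K (mixes s (y(j := a)) z) \<partial>gauss_I) = 0 \<longleftrightarrow>
    (\<integral>\<^sup>+z. indicator K (mixes s y z) \<partial>gauss_I) = 0"
proof -
  have "(mixes s (y(j := a)) z)(j := t) = (mixes s y z)(j := t)" for z t
    by auto
  then show ?thesis
    using null_mixes_iff[OF assms, of "y(j := a)" j] null_mixes_iff[OF assms, of y j] by simp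
qed

text \<open>Kolmogorov's zero-one law. Splicing shows that A is independent of every cylinder set,
  hence by approximation of itself, so its probability equals its own square.\<close>

lemma gauss_I_zero_one:
  assumes A[measurable]: "A \<in> sets gauss_I" and upd: "\<And>y j a. y(j := a) \<in> A \<longleftrightarrow> y \<in> A"
  shows "measure gauss_I A = 0 \<or> measure gauss_I A = 1"
proof -
  have fin: "(\<lambda>i. if i \<in> J then y i else z i) \<in> A \<longleftrightarrow> z \<in> A" if "finite J" for J y z
    using that
  proof induction
    case (insert j J)
    have "(\<lambda>i. if i \<in> insert j J then y i else z i) = (\<lambda>i. if i \<in> J then y i else z i)(j := y j)"
      by auto
    with insert show ?case by (simp only: upd)
  qed simp
  have indep: "measure gauss_I (A \<inter> C) = measure gauss_I A * measure gauss_I C" if C: "cylinder k C" for k C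
  proof -
    let ?m = "\<lambda>y z i. if i \<in> coords_below k then y i else z i"
    note [measurable] = cylinder_sets[OF C]
    have "?m y z \<in> C \<longleftrightarrow> y \<in> C" for y z
      by (rule cylinderD[OF C]) simp
    moreover have "?m y z \<in> A \<longleftrightarrow> z \<in> A" for y z
      by (rule fin) simp
    ultimately have "indicator (A \<inter> C) (?m y z) = indicator C y * (indicator A z :: ennreal)" for y z
      by (auto simp: indicator_def)
    then have "emeasure gauss_I (A \<inter> C) = (\<integral>\<^sup>+y. \<integral>\<^sup>+z. indicator C y * indicator A z \<partial>gauss_I \<partial>gauss_I)"
      using nn_integral_merge[of "indicator (A \<inter> C)" "coords_below k"] by simp
    also have "\<dots> = emeasure gauss_I C * emeasure gauss_I A"
      by (simp add: nn_integral_cmult nn_integral_multc)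
    finally show ?thesis
      by (simp add: gauss_I.emeasure_eq_measure mult.commute flip: ennreal_mult)
  qed
  let ?a = "measure gauss_I A"
  have "\<bar>?a - ?a * ?a\<bar> \<le> 0 + e" if "0 < e" for e
  proof -
    obtain k C where C: "cylinder k C" and e: "measure gauss_I (sym_diff A C) < e / 2"
      using cylinder_approx[OF A, of "e / 2"] \<open>0 < e\<close> by auto
    note [measurable] = cylinder_sets[OF C]
    let ?d = "measure gauss_I (sym_diff A C)"
    have "?a \<le> measure gauss_I (A \<inter> C) + ?d"
      by (intro order_trans[OF gauss_I.finite_measure_mono measure_Un_le]) auto
    moreover have "measure gauss_I (A \<inter> C) \<le> ?a"
      by (intro gauss_I.finite_measure_mono) auto
    ultimately have 1: "\<bar>?a - ?a * measure gauss_I C\<bar> \<le> ?d"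
      using indep[OF C] by simp
    have "?a \<le> measure gauss_I C + ?d" "measure gauss_I C \<le> ?a + ?d"
      by (intro order_trans[OF gauss_I.finite_measure_mono measure_Un_le]; auto)+
    then have "\<bar>measure gauss_I C - ?a\<bar> \<le> ?d" by linarith
    then have "?a * \<bar>measure gauss_I C - ?a\<bar> \<le> 1 * ?d"
      by (intro mult_mono) auto
    then have "\<bar>?a * measure gauss_I C - ?a * ?a\<bar> \<le> ?d"
      by (simp add: abs_mult flip: right_diff_distrib)
    with 1 e show ?thesis by linarith
  qed
  then have "\<bar>?a - ?a * ?a\<bar> \<le> 0" by (rule field_le_epsilon)
  then have "?a * (1 - ?a) = 0" by (simp add: algebra_simps)
  then show ?thesis by auto
qed

text \<open>The zero-one law is applied to the set of y whose section is null. If this set is null,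
  a vanishing integral would force B into it; if it has full measure, integrating over y would make
  K null, as the mixture has law \<open>gauss_I\<close>.\<close>

lemma nn_integral_mixes_pos:
  assumes [measurable]: "B \<in> sets gauss_I" "K \<in> sets gauss_I" and "s \<noteq> 0"
    and B: "measure gauss_I B > 0" and K: "measure gauss_I K > 0"
  shows "(\<integral>\<^sup>+y. \<integral>\<^sup>+z. indicator B y * indicator K (mixes s y z) \<partial>gauss_I \<partial>gauss_I) \<noteq> 0"
proof
  assume 0: "(\<integral>\<^sup>+y. \<integral>\<^sup>+z. indicator B y * indicator K (mixes s y z) \<partial>gauss_I \<partial>gauss_I) = 0"
  define h where "h y = (\<integral>\<^sup>+z. indicator K (mixes s y z) \<partial>gauss_I)" for y :: "bool list option \<Rightarrow> complex"
  have [measurable]: "h \<in> borel_measurable gauss_I"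
    unfolding h_def by measurable
  let ?A = "{y. h y = 0}"
  have "{y \<in> space gauss_I. h y = 0} \<in> sets gauss_I" by measurable
  then have A[measurable]: "?A \<in> sets gauss_I" by simp
  have "measure gauss_I ?A = 0 \<or> measure gauss_I ?A = 1"
    by (rule gauss_I_zero_one[OF A]) (use null_mixes_upd[OF assms(2,3)] in \<open>simp add: h_def\<close>)
  then show False
  proof
    assume "measure gauss_I ?A = 0"
    have "(\<integral>\<^sup>+z. indicator B y * indicator K (mixes s y z) \<partial>gauss_I) = indicator B y * h y" for y
      by (simp add: h_def nn_integral_cmult)
    with 0 have "AE y in gauss_I. indicator B y * h y = 0"
      by (simp add: nn_integral_0_iff_AE)
    then have "AE y in gauss_I. y \<in> B \<longrightarrow> y \<in> ?A"
      by eventually_elim (auto simp: indicator_def split: if_splits)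
    then have "measure gauss_I B \<le> measure gauss_I ?A"
      by (intro gauss_I.finite_measure_mono_AE) auto
    with B \<open>measure gauss_I ?A = 0\<close> show False by simp
  next
    assume "measure gauss_I ?A = 1"
    then have "AE y in gauss_I. y \<in> ?A"
      using gauss_I.prob_eq_1[OF A] by simp
    then have "(\<integral>\<^sup>+y. h y \<partial>gauss_I) = 0"
      by (simp add: nn_integral_0_iff_AE)
    moreover have "(\<integral>\<^sup>+y. h y \<partial>gauss_I) = emeasure gauss_I K"
      unfolding h_def by (subst nn_integral_mix) simp_all
    ultimately show False
      using K by (simp add: gauss_I.emeasure_eq_measure)
  qed
qed

lemma measure_UN_twist_vimage:
  assumes K[measurable]: "K \<in> sets gauss_I" and "s \<noteq> 0" and K0: "measure gauss_I K > 0"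
  shows "measure gauss_I (\<Union>k. {y. twist (- s) k y \<in> K}) = 1"
proof -
  let ?P = "measure gauss_I" and ?Q = "measure (gauss_I \<Otimes>\<^sub>M gauss_I)"
  define T where "T k A = {y. twist (- s) k y \<in> A}" for k A
  have T[measurable]: "T k A \<in> sets gauss_I" if "A \<in> sets gauss_I" for k A
    using measurable_sets[OF measurable_twist that] by (simp add: T_def vimage_def)
  have PT: "?P (T k A) = ?P A" if "A \<in> sets gauss_I" for k A
    unfolding T_def by (rule measure_twist_vimage[OF that])
  \<comment> \<open>The limit event for an independent pair. Both the first component and the
    mixture have law \<open>gauss_I\<close>, by \<open>QA\<close> and \<open>QC\<close>, so errors
    in either argument are controlled.\<close>
  define S where "S A C = {p. fst p \<in> A \<and> mixes s (fst p) (snd p) \<in> C}" for A C :: "(bool list option \<Rightarrow> complex) set"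
  have S[measurable]: "S A C \<in> sets (gauss_I \<Otimes>\<^sub>M gauss_I)"
    if [measurable]: "A \<in> sets gauss_I" "C \<in> sets gauss_I" for A C
  proof -
    have "{p \<in> space (gauss_I \<Otimes>\<^sub>M gauss_I). fst p \<in> A \<and> mixes s (fst p) (snd p) \<in> C} \<in> sets (gauss_I \<Otimes>\<^sub>M gauss_I)"
      by measurable
    then show ?thesis by (simp add: S_def space_pair_measure)
  qed
  have SI: "ennreal (?Q (S A C)) = (\<integral>\<^sup>+y. \<integral>\<^sup>+z. indicator A y * indicator C (mixes s y z) \<partial>gauss_I \<partial>gauss_I)"
    if "A \<in> sets gauss_I" "C \<in> sets gauss_I" for A C
  proof -
    note [measurable] = that
    have "ennreal (?Q (S A C)) = (\<integral>\<^sup>+p. indicator (S A C) p \<partial>(gauss_I \<Otimes>\<^sub>M gauss_I))"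
      using that by (simp add: gauss_II.emeasure_eq_measure)
    also have "\<dots> = (\<integral>\<^sup>+y. \<integral>\<^sup>+z. indicator (S A C) (y, z) \<partial>gauss_I \<partial>gauss_I)"
      using that by (intro gauss_I.nn_integral_fst[symmetric]) simp
    also have "\<dots> = (\<integral>\<^sup>+y. \<integral>\<^sup>+z. indicator A y * indicator C (mixes s y z) \<partial>gauss_I \<partial>gauss_I)"
      by (intro nn_integral_cong) (auto simp: S_def indicator_def)
    finally show ?thesis .
  qed
  have UN[measurable]: "UNIV \<in> sets gauss_I" using sets.top[of gauss_I] by simp
  have PU: "?P UNIV = 1" using gauss_I.prob_space by simp
  have QA: "?Q (S A UNIV) = ?P A" if [measurable]: "A \<in> sets gauss_I" for A
    using SI[OF that UN] by (simp add: gauss_I.emeasure_eq_measure PU)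
  have QC: "?Q (S UNIV C) = ?P C" if [measurable]: "C \<in> sets gauss_I" for C
    using SI[OF UN that] nn_integral_mix[of "indicator C" s] by (simp add: gauss_I.emeasure_eq_measure)
  have QT: "?Q (S A C) = ?P (A \<inter> T k C)" if "cylinder k A" "cylinder k C" for k A C
  proof -
    have "A \<inter> T k C = {y \<in> A. twist (- s) k y \<in> C}" by (auto simp: T_def)
    then have "ennreal (?Q (S A C)) = ennreal (?P (A \<inter> T k C))"
      using SI[OF that[THEN cylinder_sets]] emeasure_twist_cylinder[OF that, of s]
      by (simp only: gauss_I.emeasure_eq_measure)
    then show ?thesis by simp
  qed
  define B where "B = - (\<Union>k. T k K)"
  have "space gauss_I - (\<Union>k. T k K) \<in> sets gauss_I" using K by (intro sets.Diff sets.top sets.countable_UN) auto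
  then have B[measurable]: "B \<in> sets gauss_I" by (simp add: B_def Compl_eq_Diff_UNIV)
  have "?P B = 0"
  proof (rule ccontr)
    assume "?P B \<noteq> 0"
    then have "0 < ?P B" by (simp add: zero_less_measure_iff)
    then have "?Q (S B K) \<noteq> 0"
      using nn_integral_mixes_pos[OF B K \<open>s \<noteq> 0\<close> _ K0] SI[OF B K] by auto
    then have q: "0 < ?Q (S B K)" by (simp add: zero_less_measure_iff)
    \<comment> \<open>A quarter, since B and K are each exchanged for a cylinder set twice: once for
      the independent pair and once, in reverse, under the twist.\<close>
    define e where "e = ?Q (S B K) / 4"
    have "0 < e" using q by (simp add: e_def)
    obtain j B1 where B1: "cylinder j B1" "?P (sym_diff B B1) < e"
      using cylinder_approx[OF B \<open>0 < e\<close>] by auto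
    obtain l K1 where K1: "cylinder l K1" "?P (sym_diff K K1) < e"
      using cylinder_approx[OF K \<open>0 < e\<close>] by auto
    \<comment> \<open>The common level also serves as the index of the twist, so \<open>QT\<close>
      is an exact equality and no limit in k is taken.\<close>
    define k where "k = max j l"
    have cyl: "cylinder k B1" "cylinder k K1"
      using cylinder_common[OF B1(1) K1(1)] by (simp_all add: k_def)
    note [measurable] = cyl[THEN cylinder_sets]
    have "?Q (S B K) \<le> ?Q (S B1 K1 \<union> (S (sym_diff B B1) UNIV \<union> S UNIV (sym_diff K K1)))"
    proof (rule gauss_II.finite_measure_mono)
      show "S B1 K1 \<union> (S (sym_diff B B1) UNIV \<union> S UNIV (sym_diff K K1)) \<in> sets (gauss_I \<Otimes>\<^sub>M gauss_I)"
        by (intro sets.Un S sets.Diff) measurable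
    qed (auto simp: S_def)
    also have "\<dots> \<le> ?Q (S B1 K1) + (?Q (S (sym_diff B B1) UNIV) + ?Q (S UNIV (sym_diff K K1)))"
      by (intro order_trans[OF measure_Un_le] add_left_mono measure_Un_le) (auto intro!: sets.Un S sets.Diff)
    also have "\<dots> = ?P (B1 \<inter> T k K1) + (?P (sym_diff B B1) + ?P (sym_diff K K1))"
      by (simp add: QA QC QT[OF cyl])
    also have "?P (B1 \<inter> T k K1) \<le> ?P ((B \<inter> T k K) \<union> (sym_diff B B1 \<union> T k (sym_diff K K1)))"
    proof (rule gauss_I.finite_measure_mono)
      show "(B \<inter> T k K) \<union> (sym_diff B B1 \<union> T k (sym_diff K K1)) \<in> sets gauss_I"
        by (intro sets.Un sets.Int T sets.Diff) measurable
    qed (auto simp: T_def)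
    also have "\<dots> \<le> ?P (B \<inter> T k K) + (?P (sym_diff B B1) + ?P (T k (sym_diff K K1)))"
      by (intro order_trans[OF measure_Un_le] add_left_mono measure_Un_le) (auto intro!: T)
    \<comment> \<open>B avoids every translate, so only the four approximation errors
      remain.\<close>
    also have "B \<inter> T k K = {}" by (auto simp: B_def)
    also have "?P (T k (sym_diff K K1)) = ?P (sym_diff K K1)" by (rule PT) measurable
    finally have "?Q (S B K) < 4 * e" using B1(2) K1(2) by simp
    then show False by (simp add: e_def)
  qed
  moreover have "?P (\<Union>k. T k K) = 1 - ?P B"
    using gauss_I.prob_compl[OF B] by (simp add: B_def Compl_eq_Diff_UNIV double_diff)
  ultimately show ?thesis by (simp add: T_def)
qed

section \<open>Return to \<open>X_omega\<close>\<close>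

lemma unit_mult_unit_uminus: "unit s b * unit (- s) b = 1"
proof -
  have "unit (- s) b = cnj (unit s b)"
    by (cases b) (simp_all add: unit_def)
  then show ?thesis
    using complex_norm_square[of "unit s b"] by simp
qed

lemma act_gs_inverse:
  assumes "x \<in> X_omega"
  shows "act (gs s k) (act (gs (- s) k) x) = x"
proof (rule act_eqI[OF gs_in_S_level])
  show "act (gs (- s) k) x \<in> X_omega" "x \<in> X_omega"
    using assms act_spec(1)[OF gs_in_S_level] by auto
  fix \<sigma> :: "bool list" assume "Suc k \<le> length \<sigma>"
  then show "x \<sigma> = cyl_val (gs s k) \<sigma> * act (gs (- s) k) x \<sigma>"
    using unit_mult_unit_uminus[of s "\<sigma> ! k"]
    by (simp add: act_spec(2)[OF gs_in_S_level assms] cyl_val_gs flip: mult.assoc)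
qed

text \<open>Turns an image into a preimage under the inverse element; this supplies measurability
  and explains the twist by - s.\<close>

lemma act_gs_image:
  assumes "K \<subseteq> X_omega"
  shows "act (gs s k) ` K = {x \<in> X_omega. act (gs (- s) k) x \<in> K}"
proof (intro set_eqI iffI)
  fix x assume "x \<in> act (gs s k) ` K"
  then obtain y where y: "y \<in> K" "x = act (gs s k) y" by auto
  then show "x \<in> {x \<in> X_omega. act (gs (- s) k) x \<in> K}"
    using assms act_spec(1)[OF gs_in_S_level, of y s k] act_gs_inverse[of y "- s" k] by auto
next
  fix x assume "x \<in> {x \<in> X_omega. act (gs (- s) k) x \<in> K}"
  then show "x \<in> act (gs s k) ` K"
    using act_gs_inverse[of x s k] by (auto intro!: image_eqI[of x])
qed

lemma measurable_Phi: "Phi \<in> restrict_space borel X_omega \<rightarrow>\<^sub>M gauss_I"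
proof (rule measurable_gauss_I_coordwise)
  have [measurable]: "(\<lambda>x :: bool list \<Rightarrow> complex. x \<sigma>) \<in> borel_measurable borel" for \<sigma>
    by (intro borel_measurable_continuous_onI continuous_on_product_coordinates)
  show "(\<lambda>x. Phi x i) \<in> borel_measurable (restrict_space borel X_omega)" for i
    by (rule measurable_restrict_space1) (cases i; simp add: Phi_def)
qed

lemma measure_gamma_omega:
  assumes "A \<in> sets (restrict_space borel X_omega)"
  shows "measure gamma_omega A = measure gauss_I {y. Psi y \<in> A}"
  unfolding gamma_omega_eq_distr using assms by (simp add: measure_distr[OF measurable_Psi] vimage_def)

theorem theorem3p7:
  fixes K :: "(bool list \<Rightarrow> complex) set" and \<epsilon> :: real
  assumes "K \<in> sets (restrict_space borel X_omega)"
    and "0 < measure gamma_omega K"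
    and "0 < \<epsilon>"
  shows "\<exists>m n :: nat. measure gamma_omega (\<Union>k\<in>{n..n+m}. act (gs \<epsilon> k) ` K) > 1 - \<epsilon>"
proof -
  let ?K = "{y. Psi y \<in> K}"
  let ?T = "\<lambda>k. {y. twist (- \<epsilon>) k y \<in> ?K}"
  let ?V = "\<lambda>m. \<Union>k\<le>m. ?T k"
  have KX: "K \<subseteq> X_omega"
    using sets.sets_into_space[OF assms(1)] by (simp add: space_restrict_space)
  have K: "?K \<in> sets gauss_I"
    using measurable_sets[OF measurable_Psi assms(1)] by (simp add: vimage_def)
  have T: "?T k \<in> sets gauss_I" for k
    using measurable_sets[OF measurable_twist K] by (simp add: vimage_def)
  then have V: "?V m \<in> sets gauss_I" for m by auto
  have "measure gauss_I (\<Union>k. ?T k) = 1"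
    by (rule measure_UN_twist_vimage[OF K])
      (use assms in \<open>simp_all add: measure_gamma_omega\<close>)
  moreover have "(\<Union>m. ?V m) = (\<Union>k. ?T k)" by auto
  moreover have "(\<lambda>m. measure gauss_I (?V m)) \<longlonglongrightarrow> measure gauss_I (\<Union>m. ?V m)"
    by (rule gauss_I.finite_Lim_measure_incseq) (use V in \<open>auto intro!: incseq_SucI simp: atMost_Suc\<close>)
  ultimately have "(\<lambda>m. measure gauss_I (?V m)) \<longlonglongrightarrow> 1" by simp
  then have "eventually (\<lambda>m. 1 - \<epsilon> < measure gauss_I (?V m)) sequentially"
    by (rule order_tendstoD) (use assms(3) in simp)
  then obtain m where m: "1 - \<epsilon> < measure gauss_I (?V m)"
    by (auto simp: eventually_sequentially)
  \<comment> \<open>The window may start at 0, because the finite unions from 0 increase to a set of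
    full measure.\<close>
  let ?S = "\<Union>k\<in>{0..0+m}. act (gs \<epsilon> k) ` K"
  \<comment> \<open>This form gives measurability of the union in \<open>X_omega\<close>, which the
    computation of its measure requires.\<close>
  have S: "?S = Phi -` ?V m \<inter> space (restrict_space borel X_omega)"
    by (auto simp: act_gs_image[OF KX] Psi_twist Psi_Phi space_restrict_space)
  then have "?S \<in> sets (restrict_space borel X_omega)"
    using measurable_sets[OF measurable_Phi V] by simp
  moreover have "{y. Psi y \<in> ?S} = ?V m"
    unfolding S by (auto simp: Phi_Psi Psi_in space_restrict_space)
  ultimately have "measure gamma_omega ?S = measure gauss_I (?V m)"
    by (simp only: measure_gamma_omega)
  with m show ?thesis by (intro exI[of _ m] exI[of _ 0]) simp
qed

end
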